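(* For any admissible $v>1$ (that is, any $v>1$ such that a $(K_v,P_5)$-design exists), $$\mathcal{L}_1P_5(v)=\{n\geq v-1\mid n\equiv 0,1\pmod 3\}$$ and $$\{n\geq v+2\mid n\equiv 0,1\pmod 3\}\subseteq\mathcal{L}_2P_5(v)\subseteq\{n\geq v\mid n\equiv 0,1\pmod 3\}.$$
   Context: Graphs are finite and simple; $\Gamma'\leq\Gamma$ means that $\Gamma'$ is (isomorphic to) a subgraph of $\Gamma$. $K_n$ is the complete graph on $n$ vertices and $P_k$ is the path with $k$ vertices and $k-1$ edges. For graphs $\Gamma\leq K$, a $(K,\Gamma)$-design is a set of subgraphs of $K$, called blocks, each isomorphic to $\Gamma$, whose edge sets partition $E(K)$. A $(K_v,\Gamma)$-design is also called a $\Gamma$-design of order $v$. Given a $(K,\Gamma)$-design $\mathcal B$ and a $(K',\Gamma')$-design $\mathcal B'$ with $\Gamma'\leq\Gamma$, a down-link from $\mathcal B$ to $\mathcal B'$ is a function $f:\mathcal B\to\mathcal B'$ such that, for every $B\in\mathcal B$, $f(B)$ is a subgraph of $B$ (as an actual graph on the given vertices, not merely up to isomorphism). The complete graphs $K=K_v$ and $K'=K_n$ may have different vertex sets. When such an $f$ exists, $\mathcal B$ is said to be down-linked to $\mathcal B'$. Throughout, the target graph is $\Gamma'=P_4$. $\mathcal{L}_1\Gamma(v)$ is the set of all integers $n$ such that there exists some $\Gamma$-design of order $v$ that can be down-linked to some $P_4$-design of order $n$. $\mathcal{L}_2\Gamma(v)$ is the set of all integers $n$ such that every $\Gamma$-design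 of order $v$ can be down-linked to some $P_4$-design of order $n$. Here these are used with $\Gamma=P_5$. *)

theory Defs
  imports "HOL-Library.Disjoint_Sets" "HOL-Library.FuncSet" "HOL-Library.Infinite_Typeclass"
begin

type_synonym 'a graph = "'a set \<times> 'a set set"

abbreviation verts :: "'a graph \<Rightarrow> 'a set" where
  "verts \<equiv> fst"

abbreviation edges :: "'a graph \<Rightarrow> 'a set set" where
  "edges \<equiv> snd"

definition simple_graph :: "'a graph \<Rightarrow> bool" where
  "simple_graph G \<longleftrightarrow> finite (verts G) \<and> edges G \<subseteq> {e. e \<subseteq> verts G \<and> card e = 2}"

definition subgraph :: "'a graph \<Rightarrow> 'a graph \<Rightarrow> bool" where
  "subgraph H G \<longleftrightarrow>
     simple_graph H \<and> simple_graph G \<and> verts H \<subseteq> verts G \<and> edges H \<subseteq> edges G"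

definition isomorphic :: "'a graph \<Rightarrow> 'b graph \<Rightarrow> bool" where
  "isomorphic G H \<longleftrightarrow> simple_graph G \<and> simple_graph H \<and>
     (\<exists>\<phi>. bij_betw \<phi> (verts G) (verts H) \<and> edges H = (\<lambda>e. \<phi> ` e) ` edges G)"

definition embeds :: "'b graph \<Rightarrow> 'a graph \<Rightarrow> bool" where
  "embeds \<Gamma> G \<longleftrightarrow> (\<exists>H. subgraph H G \<and> isomorphic H \<Gamma>)"

definition complete_graph :: "'a set \<Rightarrow> 'a graph" where
  "complete_graph V = (V, {e. e \<subseteq> V \<and> card e = 2})"

definition path_graph :: "nat \<Rightarrow> nat graph" where
  "path_graph k = ({..<k}, {{i, Suc i} |i. Suc i < k})"

definition design :: "'a graph \<Rightarrow> 'b graph \<Rightarrow> 'a graph set \<Rightarrow> bool" where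
  "design K \<Gamma> \<B> \<longleftrightarrow> embeds \<Gamma> K \<and>
     (\<forall>B\<in>\<B>. subgraph B K \<and> isomorphic B \<Gamma>) \<and>
     disjoint_family_on edges \<B> \<and> (\<Union>B\<in>\<B>. edges B) = edges K"

definition design_of_order :: "'b graph \<Rightarrow> nat \<Rightarrow> 'a graph set \<Rightarrow> bool" where
  "design_of_order \<Gamma> v \<B> \<longleftrightarrow>
     (\<exists>V. finite V \<and> card V = v \<and> design (complete_graph V) \<Gamma> \<B>)"

text \<open>The link is between a design with blocks isomorphic to \<open>\<Gamma>\<close> and one with blocks isomorphic to
  \<open>\<Gamma>'\<close>. Containment of \<open>f B\<close> in \<open>B\<close> is literal containment of graphs, not containment up to
  isomorphism.\<close>

definition down_link ::
    "'b graph \<Rightarrow> 'c graph \<Rightarrow> 'a graph set \<Rightarrow> 'a graph set \<Rightarrow> ('a graph \<Rightarrow> 'a graph) \<Rightarrow> bool" where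
  "down_link \<Gamma> \<Gamma>' \<B> \<B>' f \<longleftrightarrow>
     embeds \<Gamma>' \<Gamma> \<and> f \<in> \<B> \<rightarrow> \<B>' \<and> (\<forall>B\<in>\<B>. subgraph (f B) B)"

definition down_linked :: "'b graph \<Rightarrow> 'c graph \<Rightarrow> 'a graph set \<Rightarrow> 'a graph set \<Rightarrow> bool" where
  "down_linked \<Gamma> \<Gamma>' \<B> \<B>' \<longleftrightarrow> (\<exists>f. down_link \<Gamma> \<Gamma>' \<B> \<B>' f)"

text \<open>The type argument is the universe from which all vertices are taken. It is meant to be
  infinite, so that designs of every order live in it and every finite vertex set can be enlarged by
  new vertices. The two designs may have different vertex sets in this universe.\<close>

definition L1 :: "'a itself \<Rightarrow> 'b graph \<Rightarrow> nat \<Rightarrow> nat set" where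
  "L1 _ \<Gamma> v = {n. \<exists>\<B> \<B>' :: 'a graph set.
     design_of_order \<Gamma> v \<B> \<and> design_of_order (path_graph 4) n \<B>' \<and>
     down_linked \<Gamma> (path_graph 4) \<B> \<B>'}"

definition L2 :: "'a itself \<Rightarrow> 'b graph \<Rightarrow> nat \<Rightarrow> nat set" where
  "L2 _ \<Gamma> v = {n. \<forall>\<B> :: 'a graph set. design_of_order \<Gamma> v \<B> \<longrightarrow>
     (\<exists>\<B>'. design_of_order (path_graph 4) n \<B>' \<and> down_linked \<Gamma> (path_graph 4) \<B> \<B>')}"

end

theory Submission
  imports Defs
begin

text \<open>A design with blocks \<open>P\<^sub>5\<close> is down-linked by removing one end edge from every block; what has to
  be found is a decomposition into copies of \<open>P\<^sub>4\<close> of the edges of the target complete graph that the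
  shortened blocks do not cover. The key fact is that a graph with at least four vertices, a number of
  edges divisible by 3 and two adjacent vertices that are adjacent to all others has such a
  decomposition. It settles \<open>n \<ge> v + 2\<close> for every design, the two dominating vertices being new. For
  smaller \<open>n\<close> one takes a special design, built by adding eight vertices at a time, in which a
  vertex \<open>x\<close> is always an end and the removed edges contain all edges from two vertices \<open>p\<close>, \<open>q\<close>:
  the dominating vertices are \<open>x\<close> and a new one if \<open>n = v + 1\<close>, and \<open>p\<close> and \<open>q\<close> if \<open>n\<close> is \<open>v - 1\<close>
  or \<open>v\<close> (with explicit decompositions for \<open>v = 8\<close> and \<open>v = 9\<close>). Conversely, a down-link loses at most one vertex, and none that is internal to some block;
  there are designs in which every vertex is internal.\<close>

text \<open>Every copy of P4 inside P5 arises by dropping an end vertex with its edge, so a block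
  keeps exactly 3 of its 4 edges. Divisibility is therefore never an obstacle: the kept edges number
  a multiple of 3, and so do all edges of K_n when n is 0 or 1 modulo 3. What can fail is the shape
  of the uncovered part, and two dominating vertices rule this out. With fewer than two new vertices
  the domination has to come from the removed edges themselves, only a quarter of the edges of K_v.
  Hence the growth by eight: since 4 divides v(v-1)/2, the order is 0 or 1 modulo 8; a rooted K_9 is
  glued on at x, and every path across has an edge from p or q to an old vertex as its removed end.
  The edges removed from x to the other six new vertices do not fit this picture. For n = v - 1 they
  vanish with x; for n = v two paths of the K_9 lose their other end edge, so that the stray removed
  edges form two copies of P4.\<close>

fun path_edges :: "'a list \<Rightarrow> 'a set list" where
  "path_edges (a # b # xs) = {a, b} # path_edges (b # xs)"
| "path_edges _ = []"

abbreviation pairs :: "'a set \<Rightarrow> 'a set set" where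
  "pairs V \<equiv> {e. e \<subseteq> V \<and> card e = 2}"

text \<open>Only edge sets are decomposed, with paths given as vertex lists. A path of four vertices
  is determined by its edges, so the vertex sets can be recovered later, and decompositions of
  disjoint edge sets combine by plain union.\<close>

inductive p4_decomp :: "'a set set \<Rightarrow> bool" where
  empty: "p4_decomp {}"
| path: "p4_decomp E \<Longrightarrow> distinct p \<Longrightarrow> length p = 4 \<Longrightarrow> set (path_edges p) \<inter> E = {} \<Longrightarrow>
    p4_decomp (set (path_edges p) \<union> E)"

lemma p4_decomp_Un:
  assumes "p4_decomp E" "p4_decomp F" "E \<inter> F = {}"
  shows "p4_decomp (E \<union> F)"
  using assms
proof induction
  case (path E p)
  then have "p4_decomp (set (path_edges p) \<union> (E \<union> F))"
    by (intro p4_decomp.path) auto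
  then show ?case by (simp add: Un_assoc)
qed simp

lemma p4_decomp_paths:
  assumes "\<forall>p\<in>set ps. distinct p \<and> length p = 4" "distinct (concat (map path_edges ps))"
  shows "p4_decomp (set (concat (map path_edges ps)))"
  using assms
proof (induction ps)
  case (Cons p ps)
  then have "p4_decomp (set (path_edges p) \<union> set (concat (map path_edges ps)))"
    by (intro p4_decomp.path) auto
  then show ?case by simp
qed (simp add: p4_decomp.empty)

text \<open>Tailored to explicit witnesses: distinctness of the concatenated edge lists says at once
  that each path has distinct edges and that the paths are edge-disjoint, and the separate equation
  for \<open>E\<close> lets the simplifier compare both sides.\<close>

lemma p4_decompI:
  assumes "\<forall>p\<in>set ps. distinct p \<and> length p = 4" "distinct (concat (map path_edges ps))"
    and "E = set (concat (map path_edges ps))"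
  shows "p4_decomp E"
  using p4_decomp_paths assms by blast

section \<open>Graphs with two dominating vertices\<close>

text \<open>The edge set of the complete bipartite graph between the two dominating vertices and
  \<open>U\<close>.\<close>

definition spokes :: "'a \<Rightarrow> 'a \<Rightarrow> 'a set \<Rightarrow> 'a set set" where
  "spokes x y U = (\<Union>u\<in>U. {{x, u}, {y, u}})"

lemma spokes_insert [simp]: "spokes x y (insert u U) = {{x, u}, {y, u}} \<union> spokes x y U"
  and spokes_empty [simp]: "spokes x y {} = {}"
  by (auto simp: spokes_def)

text \<open>This lemma and its neighbours are the small cases of the key fact. Those called
  \<open>spokes_...\<close> are pieces that can be split off; those called
  \<open>join_edge_...\<close> contain the edge \<open>{x, y}\<close> and are the graphs at which
  splitting stops. Each has a multiple of 3 edges, here 6 + 3.\<close>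

lemma spokes_triangle:
  assumes "distinct [x, y, a, b, c]"
  shows "p4_decomp (spokes x y {a, b, c} \<union> {{a, b}, {b, c}, {a, c}})"
  \<comment> \<open>The reversed list supplies every inequality in its other orientation as well, so
    that equality of doubletons is decided by rewriting.\<close>
  by (rule p4_decompI[of "[[b,x,a,y], [x,c,b,y], [b,a,c,y]]"])
    (use assms distinct_rev[THEN iffD2, OF assms] in \<open>simp_all add: doubleton_eq_iff insert_commute\<close>)

lemma join_edge_triangle_point:
  assumes "distinct [x, y, a, b, c, d]"
  shows "p4_decomp (insert {x, y} (spokes x y {a, b, c, d} \<union> {{a, b}, {b, c}, {a, c}}))"
  by (rule p4_decompI[of "[[a,x,y,b], [a,b,x,c], [c,y,d,x], [b,c,a,y]]"])
    (use assms distinct_rev[THEN iffD2, OF assms] in \<open>simp_all add: doubleton_eq_iff insert_commute\<close>)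

text \<open>The centre \<open>b\<close> keeps its own spokes, because it may be the centre of a
  larger star of which two more leaves are removed later.\<close>

lemma spokes_cherry:
  assumes "distinct [x, y, a, b, c]"
  shows "p4_decomp (spokes x y {a, c} \<union> {{a, b}, {b, c}})"
  by (rule p4_decompI[of "[[b,a,x,c], [b,c,y,a]]"])
    (use assms distinct_rev[THEN iffD2, OF assms] in \<open>simp_all add: doubleton_eq_iff insert_commute\<close>)

lemma join_edge_cherry:
  assumes "distinct [x, y, a, b, c]"
  shows "p4_decomp (insert {x, y} (spokes x y {a, b, c} \<union> {{a, b}, {b, c}}))"
  by (rule p4_decompI[of "[[a,x,y,b], [b,x,c,y], [c,b,a,y]]"])
    (use assms distinct_rev[THEN iffD2, OF assms] in \<open>simp_all add: doubleton_eq_iff insert_commute\<close>)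

lemma join_edge_edge:
  assumes "distinct [x, y, a, b]"
  shows "p4_decomp (insert {x, y} (spokes x y {a, b} \<union> {{a, b}}))"
  by (rule p4_decompI[of "[[a,x,y,b], [x,b,a,y]]"])
    (use assms distinct_rev[THEN iffD2, OF assms] in \<open>simp_all add: doubleton_eq_iff insert_commute\<close>)

lemma join_edge_four_points:
  assumes "distinct [x, y, a, b, c, d]"
  shows "p4_decomp (insert {x, y} (spokes x y {a, b, c, d}))"
  by (rule p4_decompI[of "[[a,x,y,b], [b,x,c,y], [a,y,d,x]]"])
    (use assms distinct_rev[THEN iffD2, OF assms] in \<open>simp_all add: doubleton_eq_iff insert_commute\<close>)

lemma spokes_three_points:
  assumes "distinct [x, y, a, b, c]"
  shows "p4_decomp (spokes x y {a, b, c})"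
  by (rule p4_decompI[of "[[b,x,a,y], [b,y,c,x]]"])
    (use assms distinct_rev[THEN iffD2, OF assms] in \<open>simp_all add: doubleton_eq_iff insert_commute\<close>)

lemma spokes_two_points_edge:
  assumes "distinct [x, y, a, b, c, d]"
  shows "p4_decomp (spokes x y {a, b, c, d} \<union> {{c, d}})"
  by (rule p4_decompI[of "[[b,x,a,y], [d,x,c,y], [b,y,d,c]]"])
    (use assms distinct_rev[THEN iffD2, OF assms] in \<open>simp_all add: doubleton_eq_iff insert_commute\<close>)

lemma spokes_point_two_edges:
  assumes "distinct [x, y, a, b, c, d, e]"
  shows "p4_decomp (spokes x y {a, b, c, d, e} \<union> {{b, c}, {d, e}})"
  by (rule p4_decompI[of "[[b,x,a,y], [d,x,c,y], [x,e,d,y], [c,b,y,e]]"])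
    (use assms distinct_rev[THEN iffD2, OF assms] in \<open>simp_all add: doubleton_eq_iff insert_commute\<close>)

lemma spokes_three_edges:
  assumes "distinct [x, y, a, b, c, d, e, f]"
  shows "p4_decomp (spokes x y {a, b, c, d, e, f} \<union> {{a, b}, {c, d}, {e, f}})"
  by (rule p4_decompI[of "[[b,x,a,y], [e,x,c,y], [c,d,x,f], [a,b,y,e], [d,y,f,e]]"])
    (use assms distinct_rev[THEN iffD2, OF assms] in \<open>simp_all add: doubleton_eq_iff insert_commute\<close>)

lemma card_doubleton [simp]: "card {a, b} = 2 \<longleftrightarrow> a \<noteq> b"
  by (cases "a = b") auto

lemma obtain_distinct_list:
  assumes "finite A" "k \<le> card A"
  obtains xs where "distinct xs" "set xs \<subseteq> A" "length xs = k"
proof -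
  obtain B where "B \<subseteq> A" "card B = k" "finite B"
    using obtain_subset_with_card_n[OF assms(2)] assms(1) finite_subset by metis
  then show ?thesis
    using that finite_distinct_list distinct_card by metis
qed

lemma length2_conv: "length xs = 2 \<longleftrightarrow> (\<exists>a b. xs = [a, b])"
  and length3_conv: "length xs = 3 \<longleftrightarrow> (\<exists>a b c. xs = [a, b, c])"
  and length4_conv: "length xs = 4 \<longleftrightarrow> (\<exists>a b c d. xs = [a, b, c, d])"
  by (auto simp: numeral_eq_Suc length_Suc_conv)

lemma pairs_empty: "finite A \<Longrightarrow> card A < 2 \<Longrightarrow> pairs A = {}"
  by (metis (mono_tags, lifting) Collect_empty_eq card_mono leD)

text \<open>Paths \<open>P\<^sub>4\<close> inside \<open>R\<close> are split off first. What then remains of \<open>R\<close> consists of triangles and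
  stars; these are removed together with their spokes until \<open>R\<close> is a matching.\<close>

lemma p4_decomp_join_edge_spokes:
  assumes "finite U" "x \<notin> U" "y \<notin> U" "x \<noteq> y" "R \<subseteq> pairs U" "2 \<le> card U"
    and "3 dvd 1 + 2 * card U + card R"
  shows "p4_decomp (insert {x, y} (spokes x y U \<union> R))"
  using assms
proof (induction "card U + card R" arbitrary: U R rule: less_induct)
  case less
  note fin = \<open>finite U\<close> and RU = \<open>R \<subseteq> pairs U\<close> and xy = \<open>x \<notin> U\<close> \<open>y \<notin> U\<close> \<open>x \<noteq> y\<close>
  have finR: "finite R"
    using finite_subset[OF RU] fin by simp
  have inU: "a \<in> U" "b \<in> U" "a \<noteq> b" if "{a, b} \<in> R" for a b
    using that RU by auto
  \<comment> \<open>The common step of the induction: vertices \<open>S\<close> leave with their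
    spokes, edges \<open>T\<close> leave too, and \<open>{x, y}\<close> stays behind. The number 2 *
    card S + card T of departing edges is a multiple of 3, which preserves the divisibility
    hypothesis.\<close>
  have reduce: ?case
    if S: "S \<subseteq> U" and T: "T \<subseteq> R" and ne: "S \<noteq> {} \<or> T \<noteq> {}" and R': "R - T \<subseteq> pairs (U - S)"
      and c: "2 \<le> card (U - S)" and d: "3 dvd 2 * card S + card T"
      and p: "p4_decomp (spokes x y S \<union> T)" for S T
  proof -
    have fS: "finite S" "finite T"
      using S T fin finR finite_subset by blast+
    have cS: "card U = card (U - S) + card S" "card R = card (R - T) + card T"
      using S T fS card_Diff_subset card_mono fin finR by (metis le_add_diff_inverse2)+
    have pos: "0 < card S + card T"
      using ne fS by (auto simp: card_gt_0_iff)
    have "3 dvd (1 + 2 * card (U - S) + card (R - T)) + (2 * card S + card T)"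
      using less.prems(7) unfolding cS by (simp add: algebra_simps)
    then have "3 dvd 1 + 2 * card (U - S) + card (R - T)"
      using d dvd_add_left_iff by blast
    then have "p4_decomp (insert {x, y} (spokes x y (U - S) \<union> (R - T)))"
      using less.hyps[of "U - S" "R - T"] cS pos fin xy R' c by auto
    moreover have "(spokes x y S \<union> T) \<inter> insert {x, y} (spokes x y (U - S) \<union> (R - T)) = {}"
      using S T RU xy by (auto simp: spokes_def doubleton_eq_iff)
    ultimately have "p4_decomp ((spokes x y S \<union> T) \<union> insert {x, y} (spokes x y (U - S) \<union> (R - T)))"
      using p4_decomp_Un[OF p] by blast
    moreover have "(spokes x y S \<union> T) \<union> insert {x, y} (spokes x y (U - S) \<union> (R - T))
        = insert {x, y} (spokes x y U \<union> R)"
      using S T by (auto simp: spokes_def)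
    ultimately show ?thesis by simp
  qed
  show ?case
  proof (cases "\<exists>a b c d. distinct [a, b, c, d] \<and> {a, b} \<in> R \<and> {b, c} \<in> R \<and> {c, d} \<in> R")
    case True
    then obtain a b c d where d: "distinct [a, b, c, d]" and R: "{a, b} \<in> R" "{b, c} \<in> R" "{c, d} \<in> R"
      by blast
    have "card {{a, b}, {b, c}, {c, d}} = 3"
      using d by (auto simp: doubleton_eq_iff)
    moreover have "p4_decomp {{a, b}, {b, c}, {c, d}}"
      by (rule p4_decompI[of "[[a, b, c, d]]"]) (use d in \<open>auto simp: doubleton_eq_iff\<close>)
    ultimately show ?thesis
      using reduce[of "{}" "{{a, b}, {b, c}, {c, d}}"] R RU less.prems by auto
  next
    case False
    then have no: False if "distinct [a, b, c, d]" "{a, b} \<in> R" "{b, c} \<in> R" "{c, d} \<in> R" for a b c d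
      using that by blast
    show ?thesis
    proof (cases "\<exists>a b c. a \<noteq> c \<and> {a, b} \<in> R \<and> {b, c} \<in> R")
      case True
      then obtain a b c where R: "a \<noteq> c" "{a, b} \<in> R" "{b, c} \<in> R"
        by blast
      have abc: "a \<in> U" "b \<in> U" "c \<in> U" "distinct [x, y, a, b, c]"
        using R xy inU by auto
      show ?thesis
      proof (cases "{a, c} \<in> R")
        case ac: True
        define S T where "S = {a, b, c}" and "T = {{a, b}, {b, c}, {a, c}}"
        have cST: "card S = 3" "card T = 3" "S \<subseteq> U" "T \<subseteq> R"
          using abc R ac by (auto simp: S_def T_def doubleton_eq_iff)
        have RT: "R - T \<subseteq> pairs (U - S)"
        proof
          fix e assume e: "e \<in> R - T"
          then obtain s t where st: "e = {s, t}" "s \<noteq> t" "s \<in> U" "t \<in> U"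
            using RU by (force simp: card_2_iff)
          \<comment> \<open>A triangle is a whole component of \<open>R\<close>: an edge leaving it
            would extend two of its edges to a copy of P4.\<close>
          have "False" if "u \<in> S" "{u, w} \<in> R" "{u, w} \<notin> T" for u w
          proof -
            have w: "w \<notin> S" using that inU by (auto simp: S_def T_def insert_commute)
            show False
              using that(1) no[of w a b c] no[of w b a c] no[of w c a b] that(2) w R ac abc
              by (auto simp: S_def insert_commute)
          qed
          from this[of s t] this[of t s] show "e \<in> pairs (U - S)"
            using e st by (auto simp: insert_commute)
        qed
        show ?thesis
        proof (cases "2 \<le> card (U - S)")
          case True
          then show ?thesis
            using reduce[OF \<open>S \<subseteq> U\<close> \<open>T \<subseteq> R\<close> _ RT] cST spokes_triangle[OF abc(4)]
            by (auto simp: S_def T_def)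
        next
          case False
          then have RT: "R = T"
            using pairs_empty[of "U - S"] RT cST fin by auto
          have cU: "card U = card (U - S) + 3"
            using cST fin card_mono[OF fin \<open>S \<subseteq> U\<close>] by (simp add: card_Diff_subset finite_subset)
          \<comment> \<open>With k vertices besides the triangle there are 10 + 2k edges, so k = 0
            is impossible and k = 1 leaves a triangle and a point.\<close>
          have "3 dvd 1 + 2 * (card (U - S) + 3) + 3"
            using less.prems(7) cU RT cST by simp
          moreover have "card (U - S) = 0 \<or> card (U - S) = 1"
            using False by auto
          ultimately have "card (U - S) = 1"
            by (auto dest!: dvd_imp_le elim!: dvdE) presburger
          then obtain d where d: "U - S = {d}"
            by (auto simp: card_1_singleton_iff)
          then have "U = {a, b, c, d}" "distinct [x, y, a, b, c, d]"
            using cST abc xy by (auto simp: S_def)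
          then show ?thesis
            using join_edge_triangle_point[of x y a b c d] RT by (simp add: T_def)
        qed
      next
        case ac: False
        \<comment> \<open>Without P4 and with \<open>{a, c}\<close> absent, the leaves
          \<open>a\<close> and \<open>c\<close> have no other edge of \<open>R\<close>; only these
          two vertices are removed.\<close>
        define S T where "S = {a, c}" and "T = {{a, b}, {b, c}}"
        have cST: "card S = 2" "card T = 2" "S \<subseteq> U" "T \<subseteq> R"
          using abc R by (auto simp: S_def T_def doubleton_eq_iff)
        have RT: "R - T \<subseteq> pairs (U - S)"
        proof
          fix e assume e: "e \<in> R - T"
          then obtain s t where st: "e = {s, t}" "s \<noteq> t" "s \<in> U" "t \<in> U"
            using RU by (force simp: card_2_iff)
          have "False" if "u \<in> S" "{u, w} \<in> R" "{u, w} \<notin> T" for u w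
          proof -
            have w: "w \<notin> {a, b, c}"
              using that inU[OF that(2)] ac by (auto simp: S_def T_def insert_commute)
            show False
              using that(1) no[of w a b c] no[of w c b a] that(2) w R abc
              by (auto simp: S_def insert_commute)
          qed
          from this[of s t] this[of t s] show "e \<in> pairs (U - S)"
            using e st by (auto simp: insert_commute)
        qed
        show ?thesis
        proof (cases "2 \<le> card (U - S)")
          case True
          then show ?thesis
            using reduce[OF \<open>S \<subseteq> U\<close> \<open>T \<subseteq> R\<close> _ RT] cST spokes_cherry[OF abc(4)]
            by (auto simp: S_def T_def)
        next
          case False
          then have "R = T"
            using pairs_empty[of "U - S"] RT cST fin by auto
          \<comment> \<open>The centre is still there, so it is the only vertex left besides the two
            leaves.\<close>
          have b: "b \<in> U - S"
            using abc by (auto simp: S_def)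
          have "U - S = {b}"
            using card_seteq[of "U - S" "{b}"] b False fin by auto
          moreover have "U = (U - S) \<union> S"
            using cST by blast
          ultimately have "U = {a, b, c}"
            unfolding S_def by auto
          then show ?thesis
            using join_edge_cherry[OF abc(4)] \<open>R = T\<close> by (simp add: T_def)
        qed
      qed
    next
      case False
      have edge: "\<exists>a b. e = {a, b} \<and> a \<noteq> b" if "e \<in> R" for e
        using that RU card_2_iff[of e] by auto
      have disj: "e \<inter> f = {}" if ef: "e \<in> R" "f \<in> R" "e \<noteq> f" for e f
      proof (rule ccontr)
        assume "e \<inter> f \<noteq> {}"
        then obtain b where b: "b \<in> e" "b \<in> f" by blast
        obtain a where a: "e = {a, b}"
          using edge[OF ef(1)] b(1) by (metis insert_commute insertE singletonD)
        obtain c where c: "f = {b, c}"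
          using edge[OF ef(2)] b(2) by (metis insert_commute insertE singletonD)
        have "a \<noteq> c" "{a, b} \<in> R" "{b, c} \<in> R"
          using ef a c by (auto simp: insert_commute)
        then show False using False by blast
      qed
      define I where "I = U - \<Union>R"
      have cR: "card (\<Union>T) = 2 * card T" "finite T" "\<Union>T \<subseteq> U" if "T \<subseteq> R" for T
      proof -
        show fT: "finite T" using that finR finite_subset by blast
        have "card (\<Union>T) = sum card T"
        proof (rule card_Union_disjoint)
          show "pairwise disjnt T"
            using disj that unfolding pairwise_def disjnt_def by blast
          show "finite e" if "e \<in> T" for e
            using that \<open>T \<subseteq> R\<close> RU finite_subset[OF _ fin] by blast
        qed
        also have "\<dots> = sum (\<lambda>_. 2) T"
          using that RU by (intro sum.cong) auto
        finally show "card (\<Union>T) = 2 * card T" by simp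
        show "\<Union>T \<subseteq> U" using that RU by auto
      qed
      have fI: "finite I" "I \<subseteq> U" using fin by (auto simp: I_def)
      have cU: "card U = card I + 2 * card R"
        using cR[OF order_refl] card_mono[OF fin cR(3)[OF order_refl]] finite_subset[OF _ fin]
        by (simp add: I_def card_Diff_subset)
      \<comment> \<open>Now \<open>R\<close> is a matching and \<open>I\<close> its set of uncovered
        vertices. An uncovered vertex accounts for 2 edges, a matching edge for 5: itself and four
        spokes.\<close>
      have mod: "3 dvd 1 + 2 * card I + 5 * card R"
        using less.prems(7) cU by (simp add: algebra_simps)
      have reduceM: ?thesis
        if J: "J \<subseteq> I" and T: "T \<subseteq> R" and ne: "0 < card J + card T"
          and c: "2 + card J + 2 * card T \<le> card U" and d: "3 dvd 2 * card J + 5 * card T"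
          and p: "p4_decomp (spokes x y (J \<union> \<Union>T) \<union> T)" for J T
      proof (rule reduce[OF _ T _ _ _ _ p])
        have fJ: "finite J" using J fI finite_subset by blast
        show SU: "J \<union> \<Union>T \<subseteq> U" using J fI cR[OF T] by auto
        have cS: "card (J \<union> \<Union>T) = card J + 2 * card T"
          using fJ cR[OF T] J T fin by (subst card_Un_disjoint) (auto simp: I_def intro: finite_subset)
        show "J \<union> \<Union>T \<noteq> {} \<or> T \<noteq> {}" using ne by auto
        show "2 \<le> card (U - (J \<union> \<Union>T))"
          using c cS card_Diff_subset[OF finite_subset[OF SU fin] SU] by linarith
        show "3 dvd 2 * card (J \<union> \<Union>T) + card T"
          unfolding cS using d by (simp add: algebra_simps)
        show "R - T \<subseteq> pairs (U - (J \<union> \<Union>T))"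
          using RU J T disj unfolding I_def by blast
      qed
      have pick: "\<exists>xs. distinct xs \<and> set xs \<subseteq> I \<and> length xs = k" if "k \<le> card I" for k
        using obtain_distinct_list[OF fI(1) that] by metis
      have pickR: "\<exists>es. distinct es \<and> set es \<subseteq> R \<and> length es = k" if "k \<le> card R" for k
        using obtain_distinct_list[OF finR that] by metis
      \<comment> \<open>The bound 5 keeps two vertices in place after three uncovered ones are
        gone.\<close>
      have III: ?thesis if c3: "3 \<le> card I" "5 \<le> card U"
      proof -
        obtain a b c where abc: "distinct [a, b, c]" "{a, b, c} \<subseteq> I"
          using pick[OF c3(1)] by (auto simp: length3_conv)
        then have "card {a, b, c} = 3" "distinct [x, y, a, b, c]"
          using xy fI by auto
        then show ?thesis
          using reduceM[of "{a, b, c}" "{}"] abc(2) c3 spokes_three_points[of x y a b c] by simp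
      qed
      show ?thesis
      proof (cases "card R = 0")
        case True
        then have R: "R = {}" using finR by simp
        show ?thesis
        proof (cases "card I = 4")
          case True
          then obtain a b c d where abc: "distinct [a, b, c, d]" "{a, b, c, d} \<subseteq> I"
            using pick[of 4] by (auto simp: length4_conv)
          moreover have "U = I" using R by (auto simp: I_def)
          moreover have "card {a, b, c, d} = 4" using abc by simp
          ultimately have "U = {a, b, c, d}" using card_subset_eq[OF fin] True by metis
          then show ?thesis
            using join_edge_four_points[of x y a b c d] abc R xy by auto
        next
          case False
          then have "5 \<le> card I"
            using mod True cU less.prems(6) by presburger
          then show ?thesis using III cU True by simp
        qed
      next
        case cR0: False
        show ?thesis
        proof (cases "card R = 1 \<and> card I = 0")
          case True
          then obtain e where "R = {e}" by (auto simp: card_1_singleton_iff)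
          moreover obtain a b where "e = {a, b}" "a \<noteq> b" using edge calculation by auto
          moreover have "I = {}" using True fI by simp
          ultimately have "U = {a, b}" "R = {{a, b}}" "distinct [x, y, a, b]"
            using RU xy by (auto simp: I_def)
          then show ?thesis using join_edge_edge[of x y a b] by simp
        next
          case False
          \<comment> \<open>Since 5 is 2 modulo 3, the count is 1 + 2 (card I + card R) modulo 3, so
            the number of components is 1 modulo 3. The value 1 is the single edge just
            treated.\<close>
          have im: "4 \<le> card I + card R" using mod cR0 False by presburger
          \<comment> \<open>Each component accounts for 2 modulo 3, so any three may leave together.
            The choice in each case spares a matching edge, whose ends are the two vertices that
            must remain.\<close>
          consider "3 \<le> card I" | "card I = 2" "2 \<le> card R" | "card I = 1" "3 \<le> card R"
            | "card I = 0" "4 \<le> card R" using im by linarith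
          then show ?thesis
          proof cases
            case 1
            then show ?thesis using III cU cR0 by simp
          next
            case 2
            obtain a b where ab: "distinct [a, b]" "{a, b} \<subseteq> I"
              using pick[of 2] 2 by (auto simp: length2_conv)
            obtain e where e: "e \<in> R" using cR0 finR by auto
            obtain c d where cd: "e = {c, d}" "c \<noteq> d" using edge[OF e] by auto
            have "distinct [x, y, a, b, c, d]"
              using ab cd e xy inU[of c d] fI by (auto simp: I_def)
            then have "p4_decomp (spokes x y ({a, b} \<union> \<Union>{e}) \<union> {e})"
              using spokes_two_points_edge[of x y a b c d] cd by (simp add: insert_commute)
            then show ?thesis
              using reduceM[of "{a, b}" "{e}"] ab 2 e cU by simp
          next
            case 3
            obtain a where a: "a \<in> I" using 3 by fastforce
            obtain e f where ef: "e \<noteq> f" "e \<in> R" "f \<in> R"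
              using pickR[of 2] 3 by (auto simp: length2_conv)
            obtain b c where bc: "e = {b, c}" "b \<noteq> c" using edge[OF ef(2)] by auto
            obtain d g where dg: "f = {d, g}" "d \<noteq> g" using edge[OF ef(3)] by auto
            have "distinct [x, y, a, b, c, d, g]"
              using a ef bc dg disj[OF ef(2,3,1)] xy inU[of b c] inU[of d g] fI by (auto simp: I_def)
            then have "p4_decomp (spokes x y ({a} \<union> \<Union>{e, f}) \<union> {e, f})"
              using spokes_point_two_edges[of x y a b c d g] bc dg by (simp add: insert_commute)
            then show ?thesis
              using reduceM[of "{a}" "{e, f}"] a 3 ef cU by simp
          next
            case 4
            obtain es where es: "distinct es" "set es \<subseteq> R" "length es = 3"
              using pickR[of 3] 4 by auto
            then obtain e f g where efg: "es = [e, f, g]"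
              by (metis length3_conv)
            have ef: "e \<noteq> f" "e \<noteq> g" "f \<noteq> g" "e \<in> R" "f \<in> R" "g \<in> R"
              using es unfolding efg by simp_all
            obtain a b where ab: "e = {a, b}" "a \<noteq> b" using edge[OF ef(4)] by auto
            obtain c d where cd: "f = {c, d}" "c \<noteq> d" using edge[OF ef(5)] by auto
            obtain h i where hi: "g = {h, i}" "h \<noteq> i" using edge[OF ef(6)] by auto
            have "distinct [x, y, a, b, c, d, h, i]"
              using ef ab cd hi disj[OF ef(4,5,1)] disj[OF ef(4,6,2)] disj[OF ef(5,6,3)]
                xy inU[of a b] inU[of c d] inU[of h i] by auto
            then have "p4_decomp (spokes x y ({} \<union> \<Union>{e, f, g}) \<union> {e, f, g})"
              using spokes_three_edges[of x y a b c d h i] ab cd hi by (simp add: insert_commute)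
            moreover have "card {e, f, g} = 3" using ef by simp
            ultimately show ?thesis
              using reduceM[of "{}" "{e, f, g}"] 4 ef cU by simp
          qed
        qed
      qed
    qed
  qed
qed

text \<open>Such an \<open>E\<close> consists of \<open>{x, y}\<close>, all spokes to the other
  vertices and an arbitrary rest \<open>R\<close> among those vertices. Four vertices are necessary:
  a triangle satisfies the other conditions but contains no P4.\<close>

lemma p4_decomp_two_dominating:
  assumes "finite W" "4 \<le> card W" "E \<subseteq> pairs W" "x \<in> W" "y \<in> W" "x \<noteq> y" "{x, y} \<in> E"
    and dom: "\<And>u. u \<in> W - {x, y} \<Longrightarrow> {x, u} \<in> E \<and> {y, u} \<in> E"
    and "3 dvd card E"
  shows "p4_decomp E"
proof -
  define U R where "U = W - {x, y}" and "R = E \<inter> pairs U"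
  have U: "finite U" "x \<notin> U" "y \<notin> U" "2 \<le> card U"
    using assms(1-6) by (auto simp: U_def card_Diff_subset)
  have E: "E = insert {x, y} (spokes x y U \<union> R)"
  proof
    show "E \<subseteq> insert {x, y} (spokes x y U \<union> R)"
    proof
      fix e assume "e \<in> E"
      then obtain s t where st: "e = {s, t}" "s \<noteq> t" "s \<in> W" "t \<in> W"
        using assms(3) card_2_iff[of e] by auto
      then show "e \<in> insert {x, y} (spokes x y U \<union> R)"
        using \<open>e \<in> E\<close> by (auto simp: spokes_def R_def U_def)
    qed
    show "insert {x, y} (spokes x y U \<union> R) \<subseteq> E"
      using dom \<open>{x, y} \<in> E\<close> by (auto simp: spokes_def R_def U_def)
  qed
  have sp: "card (spokes x y U) = 2 * card U \<and> finite (spokes x y U)"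
    using U(1-3)
  proof (induction U rule: finite_induct)
    case (insert u F)
    have "card ({{x, u}, {y, u}} \<union> spokes x y F) = card {{x, u}, {y, u}} + card (spokes x y F)"
      using insert by (intro card_Un_disjoint) (auto simp: spokes_def doubleton_eq_iff)
    moreover have "card {{x, u}, {y, u}} = 2"
      using \<open>x \<noteq> y\<close> insert by (auto simp: doubleton_eq_iff)
    ultimately show ?case using insert by simp
  qed simp
  have finR: "finite R" unfolding R_def using U(1) by simp
  have "card (spokes x y U \<union> R) = 2 * card U + card R"
    using sp finR U by (subst card_Un_disjoint) (auto simp: spokes_def R_def)
  moreover have "{x, y} \<notin> spokes x y U \<union> R"
    using U by (auto simp: spokes_def R_def doubleton_eq_iff)
  ultimately have "card E = 1 + 2 * card U + card R"
    using sp finR unfolding E by simp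
  then have "3 dvd 1 + 2 * card U + card R"
    using assms(9) by simp
  moreover have "R \<subseteq> pairs U" by (auto simp: R_def)
  ultimately show ?thesis
    unfolding E using U assms(6) by (intro p4_decomp_join_edge_spokes) simp_all
qed

section \<open>Path decompositions and designs\<close>

text \<open>In \<open>p5_decomp E R I\<close> the set \<open>R\<close> collects one chosen end edge of each path, to be removed by
  the down-link, and \<open>I\<close> collects the vertices that are internal to some path.\<close>

inductive p5_decomp :: "'a set set \<Rightarrow> 'a set set \<Rightarrow> 'a set \<Rightarrow> bool" where
  empty: "p5_decomp {} {} {}"
| path: "p5_decomp E R I \<Longrightarrow> distinct p \<Longrightarrow> length p = 5 \<Longrightarrow> set (path_edges p) \<inter> E = {} \<Longrightarrow>
    p5_decomp (set (path_edges p) \<union> E) (insert (hd (path_edges p)) R) (set (butlast (tl p)) \<union> I)"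

lemma p5_decomp_Un:
  assumes "p5_decomp E R I" "p5_decomp F S J" "E \<inter> F = {}"
  shows "p5_decomp (E \<union> F) (R \<union> S) (I \<union> J)"
  using assms
proof induction
  case (path E R I p)
  then have "p5_decomp (set (path_edges p) \<union> (E \<union> F)) (insert (hd (path_edges p)) (R \<union> S))
      (set (butlast (tl p)) \<union> (I \<union> J))"
    by (intro p5_decomp.path) auto
  then show ?case by (simp add: Un_assoc)
qed simp

lemma p5_decompI:
  assumes "\<forall>p\<in>set ps. distinct p \<and> length p = 5" "distinct (concat (map path_edges ps))"
    and "E = set (concat (map path_edges ps))" "R = set (map (hd \<circ> path_edges) ps)"
    and "I = set (concat (map (butlast \<circ> tl) ps))"
  shows "p5_decomp E R I"
  unfolding assms(3-5) using assms(1,2)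
proof (induction ps)
  case (Cons p ps)
  then have "p5_decomp (set (path_edges p) \<union> set (concat (map path_edges ps)))
     (insert (hd (path_edges p)) (set (map (hd \<circ> path_edges) ps)))
     (set (butlast (tl p)) \<union> set (concat (map (butlast \<circ> tl) ps)))"
    by (intro p5_decomp.path) auto
  then show ?case by simp
qed (simp add: p5_decomp.empty)

lemma length5_conv: "length xs = 5 \<longleftrightarrow> (\<exists>a b c d e. xs = [a, b, c, d, e])"
  by (auto simp: numeral_eq_Suc length_Suc_conv)

text \<open>Transfers explicit decompositions over numbers to arbitrary vertices. Injectivity on the
  union of the edges is enough because every vertex of a path lies on one of its edges.\<close>

lemma p5_decomp_image:
  assumes "p5_decomp E R I" "inj_on \<phi> (\<Union>E)"
  shows "p5_decomp ((`) \<phi> ` E) ((`) \<phi> ` R) (\<phi> ` I)"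
  using assms
proof induction
  case (path E R I p)
  obtain a b c d e where p: "p = [a, b, c, d, e]"
    using path by (auto simp: length5_conv)
  have "inj_on \<phi> (set p)"
    by (rule inj_on_subset[OF path.prems]) (force simp: p)
  then have dist: "distinct (map \<phi> p)"
    using path by (simp add: distinct_map)
  have "inj_on \<phi> (\<Union>E)"
    by (rule inj_on_subset[OF path.prems]) blast
  then have IH: "p5_decomp ((`) \<phi> ` E) ((`) \<phi> ` R) (\<phi> ` I)"
    by (rule path.IH)
  have "(`) \<phi> ` set (path_edges p) \<inter> (`) \<phi> ` E = (`) \<phi> ` (set (path_edges p) \<inter> E)"
    by (rule inj_on_image_Int[symmetric, OF inj_on_image_Pow[OF path.prems]]) auto
  also have "(`) \<phi> ` set (path_edges p) = set (path_edges (map \<phi> p))"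
    by (simp add: p)
  finally have "set (path_edges (map \<phi> p)) \<inter> (`) \<phi> ` E = {}"
    using path by simp
  with dist IH have "p5_decomp (set (path_edges (map \<phi> p)) \<union> (`) \<phi> ` E)
     (insert (hd (path_edges (map \<phi> p))) ((`) \<phi> ` R)) (set (butlast (tl (map \<phi> p))) \<union> \<phi> ` I)"
    using path by (intro p5_decomp.path) simp_all
  then show ?case by (simp add: p)
qed (simp add: p5_decomp.empty)

text \<open>The paths are edge-disjoint, so their removed edges differ and \<open>R\<close> counts
  the paths.\<close>

lemma p5_decomp_card:
  assumes "p5_decomp E R I"
  shows "finite E \<and> R \<subseteq> E \<and> card E = 4 * card R"
  using assms
proof induction
  case (path E R I p)
  obtain a b c d e where p: "p = [a, b, c, d, e]"
    using path by (auto simp: length5_conv)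
  have "card (set (path_edges p)) = 4"
    using path(2) distinct_rev[THEN iffD2, OF path(2)] by (simp add: p doubleton_eq_iff)
  moreover have "finite (set (path_edges p))" by simp
  ultimately have "card (set (path_edges p) \<union> E) = 4 + card E"
    using path card_Un_disjoint by metis
  moreover have "finite R" "{a, b} \<notin> R"
    using path finite_subset[of R E] by (auto simp: p)
  then have "card (insert {a, b} R) = 1 + card R"
    by simp
  ultimately show ?case
    using path by (auto simp: p)
qed simp

section \<open>Paths as graphs, subgraphs of complete graphs, and counting blocks\<close>

definition path_on :: "'a list \<Rightarrow> 'a graph" where
  "path_on p = (set p, set (path_edges p))"

lemma set_path_edges: "set (path_edges p) = (\<lambda>i. {p ! i, p ! Suc i}) ` {i. Suc i < length p}"
proof (induction p rule: path_edges.induct)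
  case (1 a b xs)
  have "{i. Suc i < length (a # b # xs)} = insert 0 (Suc ` {i. Suc i < length (b # xs)})"
    by (auto simp: image_iff less_Suc_eq_0_disj)
  then show ?case using 1 by (simp add: image_image)
qed auto

lemma path_edges_pairs: "distinct p \<Longrightarrow> e \<in> set (path_edges p) \<Longrightarrow> e \<subseteq> set p \<and> card e = 2"
  by (induction p rule: path_edges.induct) auto

lemma Union_path_edges: "2 \<le> length p \<Longrightarrow> \<Union>(set (path_edges p)) = set p"
proof (induction p rule: path_edges.induct)
  case (1 a b xs)
  then show ?case by (cases xs) auto
qed auto

lemma simple_graph_path_on: "distinct p \<Longrightarrow> simple_graph (path_on p)"
  using path_edges_pairs[of p] by (auto simp: simple_graph_def path_on_def)

lemma simple_graph_path_graph: "simple_graph (path_graph k)"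
  by (auto simp: simple_graph_def path_graph_def)

lemma isomorphic_path_on:
  assumes "distinct p"
  shows "isomorphic (path_on p) (path_graph (length p))"
proof -
  define \<phi> where "\<phi> = inv_into {..<length p} ((!) p)"
  have bij: "bij_betw ((!) p) {..<length p} (set p)"
    using assms bij_betw_nth by blast
  have "\<phi> (p ! i) = i" if "i < length p" for i
    using that bij by (simp add: \<phi>_def bij_betw_def inv_into_f_f)
  then have "(\<lambda>e. \<phi> ` e) ` set (path_edges p) = (\<lambda>i. {i, Suc i}) ` {i. Suc i < length p}"
    unfolding set_path_edges image_image by (intro image_cong) auto
  also have "\<dots> = {{i, Suc i} |i. Suc i < length p}"
    by auto
  finally have "(\<lambda>e. \<phi> ` e) ` set (path_edges p) = {{i, Suc i} |i. Suc i < length p}" .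
  moreover have "bij_betw \<phi> (set p) {..<length p}"
    unfolding \<phi>_def using bij by (rule bij_betw_inv_into)
  ultimately have "bij_betw \<phi> (verts (path_on p)) (verts (path_graph (length p)))
      \<and> edges (path_graph (length p)) = (\<lambda>e. \<phi> ` e) ` edges (path_on p)"
    by (simp add: path_on_def path_graph_def)
  then show ?thesis
    using assms simple_graph_path_on simple_graph_path_graph unfolding isomorphic_def by blast
qed

lemma isomorphic_card:
  assumes "isomorphic G H"
  shows "card (verts G) = card (verts H)" "card (edges G) = card (edges H)"
proof -
  obtain \<phi> where \<phi>: "bij_betw \<phi> (verts G) (verts H)" "edges H = (\<lambda>e. \<phi> ` e) ` edges G"
    and G: "simple_graph G"
    using assms by (auto simp: isomorphic_def)
  then show "card (verts G) = card (verts H)" by (simp add: bij_betw_same_card)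
  have "inj_on ((`) \<phi>) (edges G)"
    using \<phi> G by (intro inj_on_subset[OF inj_on_image_Pow[of \<phi> "verts G"]])
      (auto simp: bij_betw_def simple_graph_def)
  then show "card (edges G) = card (edges H)"
    using \<phi> by (simp add: card_image)
qed

lemma card_path_graph: "card (verts (path_graph k)) = k" "card (edges (path_graph k)) = k - 1"
proof -
  have "{{i, Suc i} |i. Suc i < k} = (\<lambda>i. {i, Suc i}) ` {..<k - 1}"
    by auto
  moreover have "inj_on (\<lambda>i. {i, Suc i}) {..<k - 1}"
    by (auto simp: inj_on_def doubleton_eq_iff)
  ultimately show "card (edges (path_graph k)) = k - 1"
    by (simp add: path_graph_def card_image)
qed (simp add: path_graph_def)

lemma simple_graph_complete: "finite V \<Longrightarrow> simple_graph (complete_graph V)"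
  by (auto simp: simple_graph_def complete_graph_def)

lemma subgraph_complete_iff:
  "finite V \<Longrightarrow> subgraph G (complete_graph V) \<longleftrightarrow> simple_graph G \<and> verts G \<subseteq> V"
  using simple_graph_complete[of V] by (auto simp: subgraph_def simple_graph_def complete_graph_def)

lemma embeds_path_complete:
  assumes "finite V" "k \<le> card V"
  shows "embeds (path_graph k) (complete_graph V)"
proof -
  obtain p where p: "distinct p" "set p \<subseteq> V" "length p = k"
    using obtain_distinct_list[OF assms] by metis
  then show ?thesis
    using isomorphic_path_on[of p] simple_graph_path_on[of p] assms
    by (auto simp: embeds_def subgraph_complete_iff path_on_def intro!: exI[of _ "path_on p"])
qed

lemma embeds_path_path:
  assumes "k \<le> l"
  shows "embeds (path_graph k) (path_graph l)"
proof -
  have "isomorphic (path_graph k) (path_graph k)"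
    unfolding isomorphic_def using simple_graph_path_graph by (auto intro!: exI[of _ id])
  moreover have "subgraph (path_graph k) (path_graph l)"
    using assms simple_graph_path_graph by (force simp: subgraph_def path_graph_def)
  ultimately show ?thesis
    unfolding embeds_def by blast
qed

text \<open>The lower bound on the order comes from the embedding clause of a design. Divisibility
  alone would admit orders 0 and 1, where there are no edges to cover.\<close>

lemma design_card:
  assumes "finite V" "design (complete_graph V) \<Gamma> \<B>"
  shows "card V choose 2 = card \<B> * card (edges \<Gamma>)" "finite \<B>" "card (verts \<Gamma>) \<le> card V"
proof -
  have B: "subgraph B (complete_graph V)" "card (edges B) = card (edges \<Gamma>)" if "B \<in> \<B>" for B
    using that assms(2) isomorphic_card(2)[of B \<Gamma>] by (simp_all add: design_def)
  have "\<B> \<subseteq> Pow V \<times> Pow (pairs V)"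
    using B(1) by (fastforce simp: subgraph_def complete_graph_def)
  then show fin: "finite \<B>"
    by (rule finite_subset) (use assms in auto)
  have "card V choose 2 = card (\<Union>B\<in>\<B>. edges B)"
    using assms by (auto simp: design_def complete_graph_def n_subsets)
  also have "\<dots> = (\<Sum>B\<in>\<B>. card (edges B))"
  proof (rule card_UN_disjoint[OF fin])
    show "\<forall>B\<in>\<B>. finite (edges B)"
    proof
      fix B assume "B \<in> \<B>"
      then have "edges B \<subseteq> pairs V" using B(1) by (simp add: subgraph_def complete_graph_def)
      then show "finite (edges B)" by (rule finite_subset) (use assms(1) in simp)
    qed
    show "\<forall>B\<in>\<B>. \<forall>C\<in>\<B>. B \<noteq> C \<longrightarrow> edges B \<inter> edges C = {}"
      using assms(2) by (auto simp: design_def disjoint_family_on_def)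
  qed
  finally show "card V choose 2 = card \<B> * card (edges \<Gamma>)"
    using B by simp
  obtain H where "subgraph H (complete_graph V)" "isomorphic H \<Gamma>"
    using assms(2) by (auto simp: design_def embeds_def)
  then show "card (verts \<Gamma>) \<le> card V"
    using isomorphic_card(1)[of H \<Gamma>] card_mono[OF assms(1), of "verts H"]
    by (simp add: subgraph_def complete_graph_def)
qed

section \<open>Admissible orders modulo 3 and modulo 8\<close>

lemma consecutive_product_mod:
  fixes w m :: nat
  shows "(w * Suc w) mod m = ((w mod m) * Suc (w mod m)) mod m"
  by (metis mod_Suc_eq mod_mult_eq mod_mod_trivial)

lemma twice_choose_two: "2 * (Suc w choose 2) = w * Suc w"
  by (simp add: choose_two dvd_mult_div_cancel)

lemma three_dvd_choose_two: "3 dvd (n choose 2) \<longleftrightarrow> n mod 3 = 0 \<or> n mod 3 = (1::nat)"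
proof (cases n)
  case (Suc w)
  have "3 dvd (n choose 2) \<longleftrightarrow> 3 dvd 2 * (n choose 2)"
    by presburger
  also have "\<dots> \<longleftrightarrow> (w * Suc w) mod 3 = 0"
    unfolding Suc twice_choose_two by (rule dvd_eq_mod_eq_0)
  also have "\<dots> \<longleftrightarrow> ((w mod 3) * Suc (w mod 3)) mod 3 = 0"
    by (subst consecutive_product_mod) (rule refl)
  also have "\<dots> \<longleftrightarrow> w mod 3 = 0 \<or> w mod 3 = 2"
  proof -
    have "w mod 3 = 0 \<or> w mod 3 = 1 \<or> w mod 3 = 2" by presburger
    then show ?thesis by (elim disjE) simp_all
  qed
  also have "\<dots> \<longleftrightarrow> n mod 3 = 0 \<or> n mod 3 = 1"
    unfolding Suc by presburger
  finally show ?thesis .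
qed (simp add: numeral_2_eq_2)

text \<open>Doubling turns the condition into 8 dividing a product of two consecutive numbers, which
  is checked on the eight residues.\<close>

lemma four_dvd_choose_two:
  assumes "4 dvd (v choose 2)"
  shows "v mod 8 = 0 \<or> v mod 8 = (1::nat)"
proof (cases v)
  case (Suc w)
  have "8 dvd 2 * (v choose 2)"
    using assms by presburger
  then have "(w * Suc w) mod 8 = 0"
    unfolding Suc twice_choose_two by (simp only: dvd_eq_mod_eq_0)
  then have "((w mod 8) * Suc (w mod 8)) mod 8 = 0"
    by (subst (asm) consecutive_product_mod)
  moreover have "w mod 8 \<in> {0, 1, 2, 3, 4, 5, 6, 7}"
    by (simp; presburger)
  ultimately have "w mod 8 = 0 \<or> w mod 8 = 7"
    by (auto dest: dvd_imp_le)
  then show ?thesis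
    unfolding Suc by presburger
qed simp

section \<open>From decompositions of edge sets to designs and down-links\<close>

lemma disjoint_family_on_insert_edges:
  "disjoint_family_on edges \<C> \<Longrightarrow> edges B \<inter> (\<Union>C\<in>\<C>. edges C) = {} \<Longrightarrow>
    disjoint_family_on edges (insert B \<C>)"
  unfolding disjoint_family_on_def by blast

lemma p4_decomp_blocks:
  assumes "p4_decomp E"
  shows "\<exists>\<C>. (\<forall>B\<in>\<C>. \<exists>p. distinct p \<and> length p = 4 \<and> B = path_on p) \<and>
    disjoint_family_on edges \<C> \<and> (\<Union>B\<in>\<C>. edges B) = E"
  using assms
proof induction
  case empty
  show ?case by (rule exI[of _ "{}"]) (simp add: disjoint_family_on_def)
next
  case (path E p)
  then obtain \<C> where C: "\<forall>B\<in>\<C>. \<exists>p. distinct p \<and> length p = 4 \<and> B = path_on p"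
    "disjoint_family_on edges \<C>" "(\<Union>B\<in>\<C>. edges B) = E" by blast
  have "disjoint_family_on edges (insert (path_on p) \<C>)"
    using C(2,3) path by (intro disjoint_family_on_insert_edges) (simp_all add: path_on_def)
  moreover have "(\<Union>B\<in>insert (path_on p) \<C>. edges B) = set (path_edges p) \<union> E"
    using C(3) by (simp add: path_on_def)
  ultimately show ?case
    using C(1) path by (intro exI[of _ "insert (path_on p) \<C>"]) auto
qed

lemma p5_decomp_blocks:
  assumes "p5_decomp E R I"
  shows "\<exists>\<B> f. (\<forall>B\<in>\<B>. \<exists>p. distinct p \<and> length p = 5 \<and> B = path_on p \<and> f B = path_on (tl p)) \<and>
    disjoint_family_on edges \<B> \<and> (\<Union>B\<in>\<B>. edges B) = E \<and> (\<Union>B\<in>\<B>. edges (f B)) = E - R \<and>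
    (\<forall>u\<in>I. \<exists>p. distinct p \<and> length p = 5 \<and> path_on p \<in> \<B> \<and> u \<in> set (butlast (tl p)))"
  using assms
proof induction
  case empty
  show ?case by (rule exI[of _ "{}"]) (simp add: disjoint_family_on_def)
next
  case (path E R I p)
  then obtain \<B> f where B: "\<forall>B\<in>\<B>. \<exists>p. distinct p \<and> length p = 5 \<and> B = path_on p \<and> f B = path_on (tl p)"
    "disjoint_family_on edges \<B>" "(\<Union>B\<in>\<B>. edges B) = E" "(\<Union>B\<in>\<B>. edges (f B)) = E - R"
    "\<forall>u\<in>I. \<exists>p. distinct p \<and> length p = 5 \<and> path_on p \<in> \<B> \<and> u \<in> set (butlast (tl p))"
    by blast
  obtain a b c d e where p: "p = [a, b, c, d, e]"
    using path by (auto simp: length5_conv)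
  define g where "g = f(path_on p := path_on (tl p))"
  \<comment> \<open>The edges of \<open>p\<close> are disjoint from those of all earlier blocks, so
    changing \<open>f\<close> at this block leaves its earlier values intact.\<close>
  have new: "path_on p \<notin> \<B>"
    using B(3) path by (auto simp: path_on_def p)
  then have g: "g B = f B" if "B \<in> \<B>" for B
    using that by (auto simp: g_def)
  have "R \<subseteq> E" using p5_decomp_card[OF path(1)] by blast
  have dist: "{a, b} \<notin> set (path_edges (tl p))"
    using path(2) by (simp add: p doubleton_eq_iff)
  have gen: "Y \<union> (E - R) = insert h Y \<union> E - insert h R" if "h \<notin> Y" "insert h Y \<inter> E = {}" for h Y
    using that \<open>R \<subseteq> E\<close> by blast
  have "set (path_edges p) = insert {a, b} (set (path_edges (tl p)))" "hd (path_edges p) = {a, b}"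
    by (simp_all add: p)
  then have rest: "set (path_edges (tl p)) \<union> (E - R) = set (path_edges p) \<union> E - insert (hd (path_edges p)) R"
    using gen[OF dist] path(4) by simp
  show ?case
  proof (intro exI[of _ "insert (path_on p) \<B>"] exI[of _ g] conjI ballI)
    show "disjoint_family_on edges (insert (path_on p) \<B>)"
      using B(2,3) path by (intro disjoint_family_on_insert_edges) (simp_all add: path_on_def)
    show "(\<Union>B\<in>insert (path_on p) \<B>. edges B) = set (path_edges p) \<union> E"
      using B(3) by (simp add: path_on_def)
    have "(\<Union>B\<in>\<B>. edges (g B)) = E - R" "edges (g (path_on p)) = set (path_edges (tl p))"
      using B(4) g by (simp_all add: g_def path_on_def)
    then show "(\<Union>B\<in>insert (path_on p) \<B>. edges (g B)) = set (path_edges p) \<union> E - insert (hd (path_edges p)) R"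
      unfolding rest[symmetric] by simp
  next
    fix B assume "B \<in> insert (path_on p) \<B>"
    then consider "B = path_on p" | "B \<in> \<B>" by blast
    then show "\<exists>q. distinct q \<and> length q = 5 \<and> B = path_on q \<and> g B = path_on (tl q)"
    proof cases
      case 1
      then show ?thesis using path(2,3) by (intro exI[of _ p]) (simp add: g_def)
    next
      case 2
      then show ?thesis using B(1) g[OF 2] by simp
    qed
  next
    fix u assume "u \<in> set (butlast (tl p)) \<union> I"
    then consider "u \<in> set (butlast (tl p))" | "u \<in> I" by blast
    then show "\<exists>q. distinct q \<and> length q = 5 \<and> path_on q \<in> insert (path_on p) \<B> \<and> u \<in> set (butlast (tl q))"
    proof cases
      case 1
      then show ?thesis using path(2,3) by (intro exI[of _ p]) simp
    next
      case 2
      then show ?thesis using B(5) by blast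
    qed
  qed
qed

text \<open>The images of the blocks together with the paths decomposing all uncovered edges are the
  blocks of the target design. Only the images have to lie in \<open>V'\<close>, not the blocks
  themselves, which is what makes targets smaller than the source possible.\<close>

lemma exists_down_link:
  assumes \<B>: "design (complete_graph V) (path_graph 5) \<B>"
    and f: "\<And>B. B \<in> \<B> \<Longrightarrow> subgraph (f B) B \<and> isomorphic (f B) (path_graph 4)"
    and V': "finite V'" "4 \<le> card V'" "\<And>B. B \<in> \<B> \<Longrightarrow> verts (f B) \<subseteq> V'"
    and dec: "p4_decomp (pairs V' - (\<Union>B\<in>\<B>. edges (f B)))"
  shows "\<exists>\<B>'. design_of_order (path_graph 4) (card V') \<B>' \<and>
    down_linked (path_graph 5) (path_graph 4) \<B> \<B>'"
proof -
  obtain \<C> where C: "\<forall>B\<in>\<C>. \<exists>p. distinct p \<and> length p = 4 \<and> B = path_on p"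
    "disjoint_family_on edges \<C>" "(\<Union>B\<in>\<C>. edges B) = pairs V' - (\<Union>B\<in>\<B>. edges (f B))"
    using p4_decomp_blocks[OF dec] by blast
  have fV: "edges (f B) \<subseteq> pairs V'" "simple_graph (f B)" if "B \<in> \<B>" for B
    using f[OF that] V'(3)[OF that] by (auto simp: subgraph_def simple_graph_def)
  have CV: "subgraph B (complete_graph V') \<and> isomorphic B (path_graph 4)" if BC: "B \<in> \<C>" for B
  proof -
    obtain p where p: "distinct p" "length p = 4" "B = path_on p"
      using C(1) BC by blast
    \<comment> \<open>Every vertex of a path lies on an edge, so control of the edges controls the
      vertices.\<close>
    have "\<Union>(edges B) \<subseteq> V'"
      using C(3) BC by blast
    then have "set p \<subseteq> V'"
      using Union_path_edges[of p] p by (simp add: path_on_def)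
    then show ?thesis
      using p isomorphic_path_on[of p] simple_graph_path_on[of p] V'(1)
      by (simp add: subgraph_complete_iff path_on_def)
  qed
  have sub: "edges (f B) \<subseteq> edges B" if "B \<in> \<B>" for B
    using f[OF that] by (simp add: subgraph_def)
  have disjB: "edges B \<inter> edges B' = {}" if "B \<in> \<B>" "B' \<in> \<B>" "B \<noteq> B'" for B B'
    using \<B> that by (auto simp: design_def disjoint_family_on_def)
  have "disjoint_family_on edges (f ` \<B> \<union> \<C>)"
    unfolding disjoint_family_on_def
  proof (intro ballI impI)
    fix A B assume "A \<in> f ` \<B> \<union> \<C>" "B \<in> f ` \<B> \<union> \<C>" "A \<noteq> B"
    then consider B1 B2 where "A = f B1" "B = f B2" "B1 \<in> \<B>" "B2 \<in> \<B>" "B1 \<noteq> B2"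
      | B1 where "A = f B1" "B1 \<in> \<B>" "B \<in> \<C>" | B1 where "B = f B1" "B1 \<in> \<B>" "A \<in> \<C>"
      | "A \<in> \<C>" "B \<in> \<C>"
      by blast
    then show "edges A \<inter> edges B = {}"
    proof cases
      case 1
      then show ?thesis using sub[of B1] sub[of B2] disjB[of B1 B2] by blast
    next
      case 2
      then show ?thesis using C(3) by blast
    next
      case 3
      then show ?thesis using C(3) by blast
    next
      case 4
      then show ?thesis using C(2) \<open>A \<noteq> B\<close> by (simp add: disjoint_family_on_def)
    qed
  qed
  moreover have "(\<Union>B\<in>f ` \<B> \<union> \<C>. edges B) = pairs V'"
    using C(3) fV(1) by (simp add: UN_Un) blast
  moreover have "\<forall>B\<in>f ` \<B> \<union> \<C>. subgraph B (complete_graph V') \<and> isomorphic B (path_graph 4)"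
  proof
    fix B assume "B \<in> f ` \<B> \<union> \<C>"
    then consider B1 where "B = f B1" "B1 \<in> \<B>" | "B \<in> \<C>" by blast
    then show "subgraph B (complete_graph V') \<and> isomorphic B (path_graph 4)"
      using CV f fV(2) V'(1,3) by cases (simp_all add: subgraph_complete_iff)
  qed
  ultimately have "design (complete_graph V') (path_graph 4) (f ` \<B> \<union> \<C>)"
    unfolding design_def using embeds_path_complete V'(1,2) by (simp add: complete_graph_def)
  moreover have "down_link (path_graph 5) (path_graph 4) \<B> (f ` \<B> \<union> \<C>) f"
    using f by (auto simp: down_link_def embeds_path_path)
  ultimately show ?thesis
    using V'(1) unfolding design_of_order_def down_linked_def by blast
qed

text \<open>The clause on \<open>verts (f B)\<close> says that the images have no isolated vertices.
  With it, \<open>V'\<close> contains the images as soon as the kept edges lie in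
  \<open>V'\<close>.\<close>

lemma design_of_p5_decomp:
  assumes "p5_decomp (pairs V) R I" "finite V" "5 \<le> card V"
  shows "\<exists>\<B> f. design (complete_graph V) (path_graph 5) \<B> \<and>
    (\<forall>B\<in>\<B>. subgraph (f B) B \<and> isomorphic (f B) (path_graph 4) \<and> verts (f B) \<subseteq> \<Union>(edges (f B))) \<and>
    (\<Union>B\<in>\<B>. edges (f B)) = pairs V - R \<and>
    (\<forall>u\<in>I. \<exists>p. distinct p \<and> length p = 5 \<and> path_on p \<in> \<B> \<and> u \<in> set (butlast (tl p)))"
proof -
  obtain \<B> f where B: "\<forall>B\<in>\<B>. \<exists>p. distinct p \<and> length p = 5 \<and> B = path_on p \<and> f B = path_on (tl p)"
    "disjoint_family_on edges \<B>" "(\<Union>B\<in>\<B>. edges B) = pairs V" "(\<Union>B\<in>\<B>. edges (f B)) = pairs V - R"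
    "\<forall>u\<in>I. \<exists>p. distinct p \<and> length p = 5 \<and> path_on p \<in> \<B> \<and> u \<in> set (butlast (tl p))"
    using p5_decomp_blocks[OF assms(1)] by blast
  have *: "subgraph B (complete_graph V) \<and> isomorphic B (path_graph 5)"
    and **: "subgraph (f B) B \<and> isomorphic (f B) (path_graph 4) \<and> verts (f B) \<subseteq> \<Union>(edges (f B))"
    if BB: "B \<in> \<B>" for B
  proof -
    obtain p where p: "distinct p" "length p = 5" "B = path_on p" "f B = path_on (tl p)"
      using B(1) BB by blast
    have "\<Union>(edges B) \<subseteq> V"
      using B(3) BB by blast
    then have "set p \<subseteq> V"
      using Union_path_edges[of p] p by (simp add: path_on_def)
    then show "subgraph B (complete_graph V) \<and> isomorphic B (path_graph 5)"
      using p isomorphic_path_on[of p] simple_graph_path_on[of p] assms(2)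
      by (simp add: subgraph_complete_iff path_on_def)
    have "isomorphic (f B) (path_graph 4)"
      using p isomorphic_path_on[of "tl p"] by (simp add: distinct_tl)
    moreover obtain a b c d e where "p = [a, b, c, d, e]"
      using p by (auto simp: length5_conv)
    then have "verts (f B) \<subseteq> verts B" "edges (f B) \<subseteq> edges B" "verts (f B) \<subseteq> \<Union>(edges (f B))"
      using p by (auto simp: path_on_def)
    moreover have "simple_graph (f B)" "simple_graph B"
      using p simple_graph_path_on[of p] simple_graph_path_on[OF distinct_tl[OF p(1)]] by simp_all
    ultimately show "subgraph (f B) B \<and> isomorphic (f B) (path_graph 4) \<and> verts (f B) \<subseteq> \<Union>(edges (f B))"
      by (simp add: subgraph_def)
  qed
  have "design (complete_graph V) (path_graph 5) \<B>"
    unfolding design_def using * B(2,3) embeds_path_complete[OF assms(2,3)]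
    by (simp add: complete_graph_def)
  then show ?thesis
    using ** B(4,5) by (intro exI[of _ \<B>] exI[of _ f]) simp
qed

lemma L1_memI:
  fixes V :: "'a set"
  assumes "p5_decomp (pairs V) R I" "finite V" "5 \<le> card V" "finite V'" "4 \<le> card V'"
    and "pairs V - R \<subseteq> pairs V'" "p4_decomp (pairs V' - (pairs V - R))"
  shows "card V' \<in> L1 TYPE('a) (path_graph 5) (card V)"
proof -
  obtain \<B> f where B: "design (complete_graph V) (path_graph 5) \<B>"
    "\<forall>B\<in>\<B>. subgraph (f B) B \<and> isomorphic (f B) (path_graph 4) \<and> verts (f B) \<subseteq> \<Union>(edges (f B))"
    "(\<Union>B\<in>\<B>. edges (f B)) = pairs V - R"
    using design_of_p5_decomp[OF assms(1-3)] by blast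
  have "verts (f B) \<subseteq> V'" if "B \<in> \<B>" for B
  proof -
    have "edges (f B) \<subseteq> pairs V'"
      using B(3) that assms(6) by blast
    then show ?thesis using bspec[OF B(2) that] by blast
  qed
  then obtain \<B>' where "design_of_order (path_graph 4) (card V') \<B>'"
      "down_linked (path_graph 5) (path_graph 4) \<B> \<B>'"
    using exists_down_link[OF B(1) _ assms(4,5), of f] B(2,3) assms(7) by auto
  moreover have "design_of_order (path_graph 5) (card V) \<B>"
    using B(1) assms(2) by (auto simp: design_of_order_def)
  ultimately show ?thesis
    unfolding L1_def by blast
qed

text \<open>Some block contains the edge joining two missing vertices. Its image would have to avoid
  two of its five vertices, but it has four.\<close>

lemma down_link_misses_at_most_one:
  assumes "design (complete_graph V) (path_graph 5) \<B>" "design (complete_graph V') (path_graph 4) \<B>'"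
    and "down_link (path_graph 5) (path_graph 4) \<B> \<B>' f"
    and "x \<in> V - V'" "y \<in> V - V'"
  shows "x = y"
proof (rule ccontr)
  assume "x \<noteq> y"
  then have "{x, y} \<in> edges (complete_graph V)"
    using assms(4,5) by (simp add: complete_graph_def)
  then obtain B where B: "B \<in> \<B>" "{x, y} \<in> edges B"
    using assms(1) unfolding design_def by blast
  have "f B \<in> \<B>'" "subgraph (f B) B"
    using assms(3) B(1) by (auto simp: down_link_def)
  then have H: "verts (f B) \<subseteq> V'" "card (verts (f B)) = 4" "verts (f B) \<subseteq> verts B"
    using assms(2) isomorphic_card(1)[of "f B" "path_graph 4"]
    by (simp_all add: design_def subgraph_def complete_graph_def card_path_graph)
  have "isomorphic B (path_graph 5)" "simple_graph B"
    using assms(1) B(1) by (simp_all add: design_def subgraph_def)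
  then have "card (verts B) = 5" "finite (verts B)" "x \<in> verts B" "y \<in> verts B"
    using isomorphic_card(1)[of B "path_graph 5"] B(2)
    by (auto simp: card_path_graph simple_graph_def)
  then have "card (verts B - {x, y}) = 3"
    using \<open>x \<noteq> y\<close> by (simp add: card_Diff_subset)
  moreover have "verts (f B) \<subseteq> verts B - {x, y}"
    using H assms(4,5) by blast
  ultimately show False
    using card_mono[of "verts B - {x, y}" "verts (f B)"] H(2) \<open>finite (verts B)\<close> by simp
qed

text \<open>Deleting an internal vertex of P5 destroys two of its four edges, and the image of the
  block needs three.\<close>

lemma down_link_keeps_internal:
  assumes "design (complete_graph V') (path_graph 4) \<B>'"
    and "down_link (path_graph 5) (path_graph 4) \<B> \<B>' f"
    and p: "distinct p" "length p = 5" "path_on p \<in> \<B>" and u: "u \<in> set (butlast (tl p))"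
  shows "u \<in> V'"
proof (rule ccontr)
  assume "u \<notin> V'"
  define H where "H = f (path_on p)"
  have "H \<in> \<B>'" "subgraph H (path_on p)"
    using assms(2) p by (auto simp: down_link_def H_def)
  then have H: "verts H \<subseteq> V'" "card (edges H) = 3" "edges H \<subseteq> set (path_edges p)" "simple_graph H"
    using assms(1) isomorphic_card(2)[of H "path_graph 4"]
    by (simp_all add: design_def subgraph_def complete_graph_def card_path_graph path_on_def)
  then have no: "edges H \<subseteq> {e \<in> set (path_edges p). u \<notin> e}"
    using \<open>u \<notin> V'\<close> by (auto simp: simple_graph_def)
  obtain a b c d e where abc: "p = [a, b, c, d, e]"
    using p by (auto simp: length5_conv)
  have two: "card {s, t} \<le> 2" for s t :: "'a set"
    by (cases "s = t") auto
  have edges_p: "set (path_edges p) = {{a, b}, {b, c}, {c, d}, {d, e}}"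
    by (simp add: abc)
  have no': "h = {a, b} \<or> h = {b, c} \<or> h = {c, d} \<or> h = {d, e}" "u \<notin> h" if "h \<in> edges H" for h
    using subsetD[OF no that] edges_p by simp_all
  consider "u = b" | "u = c" | "u = d"
    using u by (auto simp: abc)
  then obtain s t where "edges H \<subseteq> {s, t}"
  proof cases
    case 1
    then have "edges H \<subseteq> {{c, d}, {d, e}}" using no' by blast
    then show ?thesis using that by blast
  next
    case 2
    then have "edges H \<subseteq> {{a, b}, {d, e}}" using no' by blast
    then show ?thesis using that by blast
  next
    case 3
    then have "edges H \<subseteq> {{a, b}, {b, c}}" using no' by blast
    then show ?thesis using that by blast
  qed
  then have "card (edges H) \<le> 2"
    using card_mono[of "{s, t}" "edges H"] two[of s t] by simp
  then show False using H(2) by simp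
qed

section \<open>Constructions of path designs\<close>

text \<open>Coverage follows by counting: distinct edges inside the complete graph, as many as it
  has, must be all of them. So only distinctness needs to be checked for a concrete list.\<close>

lemma p5_decomp_complete:
  assumes "\<forall>p\<in>set ps. distinct p \<and> length p = 5 \<and> set p \<subseteq> {..<n}" "distinct (concat (map path_edges ps))"
    and "4 * length ps = n choose 2"
  shows "p5_decomp (pairs {..<n}) (set (map (hd \<circ> path_edges) ps)) (set (concat (map (butlast \<circ> tl) ps)))"
proof (rule p5_decompI[OF _ assms(2) _ refl refl])
  show "\<forall>p\<in>set ps. distinct p \<and> length p = 5" using assms(1) by blast
  have "e \<subseteq> {..<n} \<and> card e = 2" if "e \<in> set (path_edges p)" "p \<in> set ps" for e p
    using path_edges_pairs[OF _ that(1)] assms(1) that(2) by blast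
  then have "set (concat (map path_edges ps)) \<subseteq> pairs {..<n}"
    by auto
  moreover have "length (concat (map path_edges ps)) = 4 * length ps"
    using assms(1)
  proof (induction ps)
    case (Cons p ps)
    moreover obtain a b c d e where "p = [a, b, c, d, e]"
      using Cons.prems by (auto simp: length5_conv)
    ultimately show ?case by simp
  qed simp
  then have "card (set (concat (map path_edges ps))) = card (pairs {..<n})"
    using distinct_card[OF assms(2)] assms(3) n_subsets[of "{..<n}" 2] by simp
  ultimately show "pairs {..<n} = set (concat (map path_edges ps))"
    by (metis card_subset_eq finite_Collect_subsets finite_lessThan finite_Collect_conjI)
qed

lemma pairs_image:
  assumes "inj_on \<phi> V"
  shows "pairs (\<phi> ` V) = (`) \<phi> ` pairs V"
proof (intro equalityI subsetI)
  fix e assume e: "e \<in> pairs (\<phi> ` V)"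
  then obtain e' where "e' \<subseteq> V" "e = \<phi> ` e'"
    by (auto simp: subset_image_iff)
  then show "e \<in> (`) \<phi> ` pairs V"
    using e card_image[OF inj_on_subset[OF assms]] by auto
next
  fix e assume "e \<in> (`) \<phi> ` pairs V"
  then show "e \<in> pairs (\<phi> ` V)"
    using card_image[OF inj_on_subset[OF assms]] by auto
qed

lemma Union_pairs_subset: "\<Union>(pairs V) \<subseteq> V"
  by blast

lemma p5_decomp_relabel:
  assumes "p5_decomp (pairs {..<n}) R I" "distinct xs" "length xs = n"
  shows "p5_decomp (pairs (set xs)) ((`) ((!) xs) ` R) ((!) xs ` I)"
proof -
  have bij: "bij_betw ((!) xs) {..<n} (set xs)"
    using bij_betw_nth[OF assms(2)] assms(3) by blast
  then have inj: "inj_on ((!) xs) {..<n}" and im: "set xs = (!) xs ` {..<n}"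
    by (auto simp: bij_betw_def)
  show ?thesis
    unfolding im pairs_image[OF inj]
    by (rule p5_decomp_image[OF assms(1) inj_on_subset[OF inj Union_pairs_subset]])
qed

text \<open>A starter path rotated modulo 7, with 0 in the role of \<open>x\<close> as fixed point:
  the path 0, i, i+1, i-1, i+2 uses each of the differences 1, 2, 3 once and one edge at the fixed
  point.\<close>

lemma p5_decomp_K8_rooted:
  assumes "distinct [x, a, b, c, d, e, f, g]"
  shows "p5_decomp (pairs {x, a, b, c, d, e, f, g}) {{x, a}, {x, b}, {x, c}, {x, d}, {x, e}, {x, f}, {x, g}}
    {a, b, c, d, e, f, g}"
proof -
  have "p5_decomp (pairs {..<8::nat}) {{0, 1}, {0, 2}, {0, 3}, {0, 4}, {0, 5}, {0, 6}, {0, 7}} {1, 2, 3, 4, 5, 6, 7}"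
    using p5_decomp_complete[of "[[0, 1, 2, 7, 3], [0, 2, 3, 1, 4], [0, 3, 4, 2, 5], [0, 4, 5, 3, 6],
      [0, 5, 6, 4, 7], [0, 6, 7, 5, 1], [0, 7, 1, 6, 2]]" 8]
    by (simp add: doubleton_eq_iff choose_two insert_commute)
  from p5_decomp_relabel[OF this assms] show ?thesis by simp
qed

text \<open>In the rooted design \<open>x\<close> is never internal, so the upper bound on
  \<open>L2\<close> calls for another base design.\<close>

lemma p5_decomp_K8_internal:
  assumes "card V = 8"
  shows "\<exists>R. p5_decomp (pairs V) R V"
proof -
  obtain xs where xs: "distinct xs" "set xs = V" "length xs = 8"
    using obtain_distinct_list[of V 8] assms card.infinite
    by (metis card_subset_eq distinct_card le_refl zero_neq_numeral)
  have "p5_decomp (pairs {..<8::nat}) {{2, 3}, {1, 6}, {1, 2}, {4, 7}, {3, 7}, {1, 4}, {3, 6}} {0, 1, 2, 3, 4, 5, 6, 7}"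
    using p5_decomp_complete[of "[[2, 3, 4, 0, 7], [6, 1, 5, 2, 7], [1, 2, 4, 5, 6], [7, 4, 6, 0, 1],
      [3, 7, 6, 2, 0], [4, 1, 3, 0, 5], [6, 3, 5, 7, 1]]" 8]
    by (simp add: doubleton_eq_iff choose_two insert_commute)
  from p5_decomp_relabel[OF this xs(1,3)] have "\<exists>R. p5_decomp (pairs V) R ((!) xs ` {0, 1, 2, 3, 4, 5, 6, 7})"
    unfolding xs(2) by blast
  moreover have "{0, 1, 2, 3, 4, 5, 6, 7} = {..<8::nat}" by auto
  moreover have "(!) xs ` {..<8} = V"
    using bij_betw_nth[OF xs(1), of "{..<8}" V] xs by (simp add: bij_betw_def)
  ultimately show ?thesis by (simp only:)
qed

lemma p5_decomp_K9_internal: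
  assumes "card V = 9"
  shows "\<exists>R. p5_decomp (pairs V) R V"
proof -
  obtain xs where xs: "distinct xs" "set xs = V" "length xs = 9"
    using obtain_distinct_list[of V 9] assms card.infinite
    by (metis card_subset_eq distinct_card le_refl zero_neq_numeral)
  have "p5_decomp (pairs {..<9::nat}) {{1, 3}, {1, 7}, {0, 2}, {0, 5}, {5, 6}, {2, 4}, {3, 4}, {5, 8}, {1, 6}}
      {0, 1, 2, 3, 4, 5, 6, 7, 8}"
    using p5_decomp_complete[of "[[3, 1, 2, 5, 7], [7, 1, 5, 3, 2], [2, 0, 6, 3, 8], [5, 0, 4, 1, 8],
      [6, 5, 4, 8, 7], [4, 2, 6, 7, 0], [3, 4, 6, 8, 0], [5, 8, 2, 7, 4], [6, 1, 0, 3, 7]]" 9]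
    by (simp add: doubleton_eq_iff choose_two insert_commute)
  from p5_decomp_relabel[OF this xs(1,3)] have "\<exists>R. p5_decomp (pairs V) R ((!) xs ` {0, 1, 2, 3, 4, 5, 6, 7, 8})"
    unfolding xs(2) by blast
  moreover have "{0, 1, 2, 3, 4, 5, 6, 7, 8} = {..<9::nat}" by auto
  moreover have "(!) xs ` {..<9} = V"
    using bij_betw_nth[OF xs(1), of "{..<9}" V] xs by (simp add: bij_betw_def)
  ultimately show ?thesis by (simp only:)
qed

text \<open>K_9 needs nine paths but \<open>x\<close> has only eight edges. The ninth path starts
  with \<open>{p, q}\<close>, the edge required between the two future dominating vertices.\<close>

lemma p5_decomp_K9_rooted:
  assumes "distinct [x, p, q, a, b, c, d, e, f]"
  shows "p5_decomp (pairs {x, p, q, a, b, c, d, e, f})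
    {{x, p}, {x, q}, {x, a}, {x, b}, {x, c}, {x, d}, {x, e}, {x, f}, {p, q}} {p, q, a, b, c, d, e, f}"
proof -
  have "p5_decomp (pairs {..<9::nat}) {{0, 1}, {0, 2}, {0, 3}, {0, 4}, {0, 5}, {0, 6}, {0, 7}, {0, 8}, {1, 2}}
      {1, 2, 3, 4, 5, 6, 7, 8}"
    using p5_decomp_complete[of "[[0, 1, 3, 8, 4], [0, 2, 5, 6, 7], [0, 3, 2, 6, 1], [0, 4, 2, 8, 1],
      [0, 5, 8, 7, 3], [0, 6, 4, 1, 7], [0, 7, 4, 5, 1], [0, 8, 6, 3, 4], [1, 2, 7, 5, 3]]" 9]
    by (simp add: doubleton_eq_iff choose_two insert_commute)
  from p5_decomp_relabel[OF this assms] show ?thesis by simp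
qed

text \<open>The paths are those of \<open>p5_decomp_K9_rooted\<close>, but the two that begin with the edges \<open>xe\<close> and \<open>xf\<close>
  lose their other end edge.\<close>

lemma p5_decomp_K9_flipped:
  assumes "distinct [x, p, q, a, b, c, d, e, f]"
  shows "\<exists>I. p5_decomp (pairs {x, p, q, a, b, c, d, e, f})
    ({{x, p}, {x, q}, {p, q}} \<union> {{x, a}, {x, b}, {x, c}, {x, d}, {p, c}, {a, b}}) I"
proof -
  \<comment> \<open>Here 7 and 8 are \<open>e\<close> and \<open>f\<close>: reversing their two
    paths trades the removed edges xe and xf for pc and ab. The removed edges outside the triangle
    xpq then form the paths p, c, x, a and a, b, x, d.\<close>
  have "p5_decomp (pairs {..<9::nat}) {{0, 1}, {0, 2}, {1, 2}, {0, 3}, {0, 4}, {0, 5}, {0, 6}, {1, 5}, {3, 4}}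
      {1, 2, 3, 4, 5, 6, 7, 8}"
    using p5_decomp_complete[of "[[0, 1, 3, 8, 4], [0, 2, 5, 6, 7], [0, 3, 2, 6, 1], [0, 4, 2, 8, 1],
      [0, 5, 8, 7, 3], [0, 6, 4, 1, 7], [1, 5, 4, 7, 0], [4, 3, 6, 8, 0], [1, 2, 7, 5, 3]]" 9]
    by (simp add: doubleton_eq_iff choose_two insert_commute)
  from p5_decomp_relabel[OF this assms] show ?thesis by (auto simp: insert_commute)
qed

text \<open>One path per vertex \<open>w\<close>, starting with the edge from \<open>s\<close> to
  \<open>w\<close>, so that \<open>w\<close> is internal and the removed edges form the full star at
  \<open>s\<close>. Vertices of \<open>W\<close> are treated in pairs, with one triple if their
  number is odd.\<close>

lemma p5_decomp_K4_join:
  assumes "finite W" "2 \<le> card W" "distinct [s, a, b, c]" "{s, a, b, c} \<inter> W = {}"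
  shows "\<exists>I. W \<subseteq> I \<and> p5_decomp (\<Union>w\<in>W. {{s, w}, {a, w}, {b, w}, {c, w}}) ((\<lambda>w. {s, w}) ` W) I"
  using assms(1,2,4)
proof (induction "card W" arbitrary: W rule: less_induct)
  case less
  have pair: "p5_decomp (\<Union>w\<in>{u, v}. {{s, w}, {a, w}, {b, w}, {c, w}}) ((\<lambda>w. {s, w}) ` {u, v}) {u, v, a, c}"
    if "distinct [s, a, b, c, u, v]" for u v
    by (rule p5_decompI[of "[[s, u, a, v, b], [s, v, c, u, b]]"])
      (use that distinct_rev[THEN iffD2, OF that] in \<open>simp_all add: doubleton_eq_iff insert_commute\<close>)
  have triple: "p5_decomp (\<Union>w\<in>{u, v, w}. {{s, w}, {a, w}, {b, w}, {c, w}}) ((\<lambda>w. {s, w}) ` {u, v, w})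
      {u, v, w, a, b, c}" if "distinct [s, a, b, c, u, v, w]" for u v w
    by (rule p5_decompI[of "[[s, u, a, v, b], [s, v, c, w, a], [s, w, b, u, c]]"])
      (use that distinct_rev[THEN iffD2, OF that] in \<open>simp_all add: doubleton_eq_iff insert_commute\<close>)
  show ?case
  proof (cases "card W = 3")
    case True
    then obtain u v w where W: "W = {u, v, w}" "u \<noteq> v" "u \<noteq> w" "v \<noteq> w"
      by (auto simp: card_3_iff)
    then have "distinct [s, a, b, c, u, v, w]"
      using assms(3) less.prems(3) by auto
    from triple[OF this] show ?thesis
      unfolding W(1) by (intro exI[of _ "{u, v, w, a, b, c}"] conjI) auto
  next
    \<comment> \<open>Having excluded size 3, removing a pair leaves either nothing or at least two
      vertices.\<close>
    case False
    obtain xs where xs: "distinct xs" "set xs \<subseteq> W" "length xs = 2"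
      using obtain_distinct_list[OF less.prems(1,2)] .
    then obtain u v where uv: "xs = [u, v]" by (auto simp: length2_conv)
    have d: "distinct [s, a, b, c, u, v]"
      using assms(3) less.prems(3) xs uv by auto
    define T where "T = W - {u, v}"
    have W: "W = {u, v} \<union> T" "{u, v} \<inter> T = {}" "card T = card W - 2" "finite T"
      using xs uv less.prems(1) by (auto simp: T_def card_Diff_subset)
    show ?thesis
    proof (cases "card W = 2")
      case True
      then have "T = {}" using W(3,4) by simp
      then have "W = {u, v}" using W(1) by simp
      then show ?thesis using pair[OF d] by (intro exI[of _ "{u, v, a, c}"] conjI) simp_all
    next
      case F2: False
      then have "2 \<le> card T" "card T < card W" "{s, a, b, c} \<inter> T = {}"
        using False less.prems W by auto
      then obtain I where I: "T \<subseteq> I" "p5_decomp (\<Union>w\<in>T. {{s, w}, {a, w}, {b, w}, {c, w}}) ((\<lambda>w. {s, w}) ` T) I"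
        using less.hyps W(4) by blast
      have "(\<Union>w\<in>{u, v}. {{s, w}, {a, w}, {b, w}, {c, w}}) \<inter> (\<Union>w\<in>T. {{s, w}, {a, w}, {b, w}, {c, w}}) = {}"
        using W(2) d by (auto simp: doubleton_eq_iff)
      from p5_decomp_Un[OF pair[OF d] I(2) this]
      have "p5_decomp (\<Union>w\<in>W. {{s, w}, {a, w}, {b, w}, {c, w}}) ((\<lambda>w. {s, w}) ` W) ({u, v, a, c} \<union> I)"
        unfolding W(1) UN_Un Union_Un_distrib image_Un .
      moreover have "W \<subseteq> {u, v, a, c} \<union> I"
        using I(1) by (subst W(1)) blast
      ultimately show ?thesis by blast
    qed
  qed
qed

text \<open>The two designs share the vertex \<open>x\<close>. The edges between \<open>U - {x}\<close> and the new vertices are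
  covered by paths that start in \<open>p\<close> and alternate between \<open>U - {x}\<close> and \<open>a\<close>, \<open>b\<close>, \<open>c\<close>, and by the
  same for \<open>q\<close> and \<open>d\<close>, \<open>e\<close>, \<open>f\<close>.\<close>

lemma p5_decomp_extend_by_eight:
  assumes U: "finite U" "x \<in> U" "3 \<le> card U" "p5_decomp (pairs U) R I"
    and A: "distinct [p, q, a, b, c, d, e, f]" "{p, q, a, b, c, d, e, f} \<inter> U = {}"
    and S: "p5_decomp (pairs {x, p, q, a, b, c, d, e, f}) S J"
  shows "\<exists>L. U - {x} \<subseteq> L \<and>
    p5_decomp (pairs (U \<union> {p, q, a, b, c, d, e, f})) (R \<union> S \<union> spokes p q (U - {x})) (I \<union> J \<union> L)"
proof -
  let ?W = "U - {x}"
  have W: "finite ?W" "2 \<le> card ?W" "{p, a, b, c} \<inter> ?W = {}" "{q, d, e, f} \<inter> ?W = {}"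
    using U A by auto
  obtain L where L: "?W \<subseteq> L" "p5_decomp (\<Union>w\<in>?W. {{p, w}, {a, w}, {b, w}, {c, w}}) ((\<lambda>w. {p, w}) ` ?W) L"
    using p5_decomp_K4_join[of ?W p a b c] W A by auto
  obtain M where M: "?W \<subseteq> M" "p5_decomp (\<Union>w\<in>?W. {{q, w}, {d, w}, {e, w}, {f, w}}) ((\<lambda>w. {q, w}) ` ?W) M"
    using p5_decomp_K4_join[of ?W q d e f] W A by auto
  let ?A = "{p, q, a, b, c, d, e, f}"
  let ?P = "\<Union>w\<in>?W. {{p, w}, {a, w}, {b, w}, {c, w}}" and ?Q = "\<Union>w\<in>?W. {{q, w}, {d, w}, {e, w}, {f, w}}"
  have cross: "?P \<union> ?Q = {{s, w} |s w. s \<in> ?A \<and> w \<in> ?W}"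
    by auto
  have "pairs U \<inter> pairs (insert x ?A) = {}"
  proof -
    have False if "h \<in> pairs U" "h \<in> pairs (insert x ?A)" for h
    proof -
      have "h \<subseteq> {x}" using that A(2) by blast
      then have "card h \<le> 1" using card_mono[of "{x}" h] by simp
      then show False using that by simp
    qed
    then show ?thesis by blast
  qed
  from p5_decomp_Un[OF U(4) S this]
  have 1: "p5_decomp (pairs U \<union> pairs (insert x ?A)) (R \<union> S) (I \<union> J)" .
  have "?P \<inter> ?Q = {}"
    using A by (auto simp: doubleton_eq_iff)
  from p5_decomp_Un[OF L(2) M(2) this]
  have 2: "p5_decomp (?P \<union> ?Q) ((\<lambda>w. {p, w}) ` ?W \<union> (\<lambda>w. {q, w}) ` ?W) (L \<union> M)" .
  have "h \<notin> pairs U \<union> pairs (insert x ?A)" if "h = {s, w}" "s \<in> ?A" "w \<in> ?W" for h s w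
    using that A(2) by blast
  then have "(pairs U \<union> pairs (insert x ?A)) \<inter> (?P \<union> ?Q) = {}"
    unfolding cross by blast
  from p5_decomp_Un[OF 1 2 this]
  have "p5_decomp (pairs U \<union> pairs (insert x ?A) \<union> (?P \<union> ?Q))
     (R \<union> S \<union> ((\<lambda>w. {p, w}) ` ?W \<union> (\<lambda>w. {q, w}) ` ?W)) (I \<union> J \<union> (L \<union> M))" .
  moreover have "pairs U \<union> pairs (insert x ?A) \<union> (?P \<union> ?Q) = pairs (U \<union> ?A)"
  proof (intro equalityI subsetI)
    fix h assume "h \<in> pairs (U \<union> ?A)"
    then obtain s t where st: "h = {s, t}" "s \<noteq> t" "s \<in> U \<union> ?A" "t \<in> U \<union> ?A"
      using card_2_iff[of h] by auto
    have "h \<in> pairs U \<or> h \<in> pairs (insert x ?A) \<or> h \<in> {{s, w} |s w. s \<in> ?A \<and> w \<in> ?W}"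
      using st by (cases "s \<in> U"; cases "t \<in> U"; cases "s = x"; cases "t = x") (auto simp: insert_commute)
    then show "h \<in> pairs U \<union> pairs (insert x ?A) \<union> (?P \<union> ?Q)"
      unfolding cross by blast
  next
    fix h assume "h \<in> pairs U \<union> pairs (insert x ?A) \<union> (?P \<union> ?Q)"
    then consider "h \<in> pairs U" | "h \<in> pairs (insert x ?A)" | s w where "h = {s, w}" "s \<in> ?A" "w \<in> ?W"
      unfolding cross by blast
    then show "h \<in> pairs (U \<union> ?A)"
    proof cases
      case 2
      then show ?thesis using U(2) by blast
    next
      case 3
      then have "s \<noteq> w" using A(2) by blast
      then show ?thesis using 3 by auto
    qed auto
  qed
  moreover have "(\<lambda>w. {p, w}) ` ?W \<union> (\<lambda>w. {q, w}) ` ?W = spokes p q ?W"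
    by (auto simp: spokes_def)
  ultimately have "p5_decomp (pairs (U \<union> ?A)) (R \<union> S \<union> spokes p q ?W) (I \<union> J \<union> (L \<union> M))"
    by (simp only:)
  moreover have "?W \<subseteq> L \<union> M" using L(1) by blast
  ultimately show ?thesis by blast
qed

section \<open>Rooted designs and designs with all vertices internal, by steps of eight
  vertices\<close>

lemma enumerate_with_head:
  assumes "finite V" "x \<in> V"
  obtains xs where "distinct (x # xs)" "set (x # xs) = V" "length (x # xs) = card V"
proof -
  obtain xs where xs: "set xs = V - {x}" "distinct xs"
    using finite_distinct_list assms(1) by blast
  have "distinct (x # xs)" "set (x # xs) = V"
    using xs assms(2) by auto
  then show ?thesis
    using that distinct_card[of "x # xs"] by metis
qed

lemma edge_at_vertex:
  assumes "h \<in> pairs V" "x \<in> h"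
  shows "\<exists>w\<in>V. w \<noteq> x \<and> h = {x, w}"
proof -
  have "card h = 2" "h \<subseteq> V" using assms(1) by auto
  then obtain s t where "h = {s, t}" "s \<noteq> t" by (auto simp: card_2_iff)
  then show ?thesis using assms(2) \<open>h \<subseteq> V\<close> by auto
qed

lemma split_off_eight:
  assumes "finite V" "16 \<le> card V" "x \<in> V"
  obtains U p q a b c d e f where "V = U \<union> {p, q, a, b, c, d, e, f}" "x \<in> U" "finite U"
    "card V = card U + 8" "distinct [p, q, a, b, c, d, e, f]" "{p, q, a, b, c, d, e, f} \<inter> U = {}"
proof -
  have fin: "finite (V - {x})" "8 \<le> card (V - {x})" using assms by simp_all
  obtain xs where xs: "distinct xs" "set xs \<subseteq> V - {x}" "length xs = 8"
    by (rule obtain_distinct_list[OF fin])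
  then obtain p q a b c d e f where l: "xs = [p, q, a, b, c, d, e, f]"
    by (auto simp: numeral_eq_Suc length_Suc_conv)
  have "V = (V - set xs) \<union> set xs" "x \<in> V - set xs" "finite (V - set xs)" "set xs \<inter> (V - set xs) = {}"
    using xs assms by auto
  moreover have "card V = card (V - set xs) + 8"
  proof -
    have "set xs \<subseteq> V" "card (set xs) = 8" using xs distinct_card[OF xs(1)] by auto
    then show ?thesis using card_mono[OF assms(1), of "set xs"] by (simp add: card_Diff_subset)
  qed
  ultimately show ?thesis
    using that xs(1) unfolding l list.set by metis
qed

lemma rooted_extend:
  assumes "x \<in> U" "{h \<in> pairs U. x \<in> h} \<subseteq> R"
  shows "{h \<in> pairs (U \<union> {p, q, a, b, c, d, e, f}). x \<in> h} \<subseteq>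
    R \<union> {{x, p}, {x, q}, {x, a}, {x, b}, {x, c}, {x, d}, {x, e}, {x, f}, {p, q}} \<union> S"
proof
  fix h assume "h \<in> {h \<in> pairs (U \<union> {p, q, a, b, c, d, e, f}). x \<in> h}"
  then obtain w where w: "w \<in> U \<union> {p, q, a, b, c, d, e, f}" "w \<noteq> x" "h = {x, w}"
    using edge_at_vertex[of h "U \<union> {p, q, a, b, c, d, e, f}" x] by blast
  show "h \<in> R \<union> {{x, p}, {x, q}, {x, a}, {x, b}, {x, c}, {x, d}, {x, e}, {x, f}, {p, q}} \<union> S"
  proof (cases "w \<in> U")
    case True
    then have "h \<in> {h \<in> pairs U. x \<in> h}" using w(2,3) assms(1) by simp
    from subsetD[OF assms(2) this] show ?thesis by simp
  next
    case False
    then have "w \<in> {p, q, a, b, c, d, e, f}" using w(1) by simp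
    then show ?thesis unfolding w(3) by (elim insertE emptyE) simp_all
  qed
qed

text \<open>The attached K_9 is rooted at the same \<open>x\<close> and the paths across avoid
  \<open>x\<close>, so \<open>x\<close> remains an end throughout and its whole star is
  removed.\<close>

lemma p5_decomp_rooted:
  assumes "finite V" "x \<in> V" "8 \<le> card V" "card V mod 8 = 0 \<or> card V mod 8 = 1"
  shows "\<exists>R I. p5_decomp (pairs V) R I \<and> {h \<in> pairs V. x \<in> h} \<subseteq> R"
  using assms
proof (induction "card V" arbitrary: V rule: less_induct)
  case less
  have at_x: "\<exists>w\<in>W. h = {x, w}" if "h \<in> pairs (insert x W)" "x \<in> h" for h W
    using edge_at_vertex[OF that] by blast
  show ?case
  proof (cases "16 \<le> card V")
    case True
    obtain U p q a b c d e f where V: "V = U \<union> {p, q, a, b, c, d, e, f}" "x \<in> U" "finite U" "card V = card U + 8"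
      and A: "distinct [p, q, a, b, c, d, e, f]" "{p, q, a, b, c, d, e, f} \<inter> U = {}"
      by (rule split_off_eight[OF less.prems(1) True less.prems(2)])
    have d: "distinct [x, p, q, a, b, c, d, e, f]" using A V(2) by auto
    obtain R I where R: "p5_decomp (pairs U) R I" "{h \<in> pairs U. x \<in> h} \<subseteq> R"
      using less.hyps[of U] V True less.prems(4) by auto
    obtain L where L: "p5_decomp (pairs V) (R \<union> {{x, p}, {x, q}, {x, a}, {x, b}, {x, c}, {x, d}, {x, e}, {x, f}, {p, q}}
        \<union> spokes p q (U - {x})) L"
      using p5_decomp_extend_by_eight[OF V(3,2) _ R(1) A p5_decomp_K9_rooted[OF d]] V(1,4) True by auto
    have root: "{h \<in> pairs V. x \<in> h} \<subseteq> R \<union> {{x, p}, {x, q}, {x, a}, {x, b}, {x, c}, {x, d}, {x, e}, {x, f}, {p, q}}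
        \<union> spokes p q (U - {x})"
      unfolding V(1) by (rule rooted_extend[OF V(2) R(2)])
    show ?thesis
      by (rule exI, rule exI, rule conjI[OF L root])
  next
    case False
    then have "card V = 8 \<or> card V = 9" using less.prems by presburger
    then show ?thesis
    proof
      assume 8: "card V = 8"
      obtain xs where xs: "distinct (x # xs)" "set (x # xs) = V" "length (x # xs) = card V"
        by (rule enumerate_with_head[OF less.prems(1,2)])
      then have "length xs = 7" using 8 by simp
      then obtain a b c d e f g where l: "xs = [a, b, c, d, e, f, g]"
        by (auto simp: numeral_eq_Suc length_Suc_conv)
      have d: "distinct [x, a, b, c, d, e, f, g]" using xs l by auto
      have V: "V = insert x {a, b, c, d, e, f, g}" using xs(2) by (simp add: l)
      have root: "{h \<in> pairs V. x \<in> h} \<subseteq> {{x, a}, {x, b}, {x, c}, {x, d}, {x, e}, {x, f}, {x, g}}"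
      proof
        fix h assume "h \<in> {h \<in> pairs V. x \<in> h}"
        then obtain w where "w \<in> {a, b, c, d, e, f, g}" and h: "h = {x, w}"
          using at_x[of h "{a, b, c, d, e, f, g}"] unfolding V by blast
        then show "h \<in> {{x, a}, {x, b}, {x, c}, {x, d}, {x, e}, {x, f}, {x, g}}"
          unfolding h by (elim insertE emptyE) simp_all
      qed
      have dec: "p5_decomp (pairs V) {{x, a}, {x, b}, {x, c}, {x, d}, {x, e}, {x, f}, {x, g}} {a, b, c, d, e, f, g}"
        using p5_decomp_K8_rooted[OF d] unfolding V .
      show ?thesis
        by (rule exI, rule exI, rule conjI[OF dec root])
    next
      assume 9: "card V = 9"
      obtain xs where xs: "distinct (x # xs)" "set (x # xs) = V" "length (x # xs) = card V"
        by (rule enumerate_with_head[OF less.prems(1,2)])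
      then have "length xs = 8" using 9 by simp
      then obtain p q a b c d e f where l: "xs = [p, q, a, b, c, d, e, f]"
        by (auto simp: numeral_eq_Suc length_Suc_conv)
      have d: "distinct [x, p, q, a, b, c, d, e, f]" using xs l by auto
      have V: "V = insert x {p, q, a, b, c, d, e, f}" using xs(2) by (simp add: l)
      have root: "{h \<in> pairs V. x \<in> h} \<subseteq> {{x, p}, {x, q}, {x, a}, {x, b}, {x, c}, {x, d}, {x, e}, {x, f}, {p, q}}"
      proof
        fix h assume "h \<in> {h \<in> pairs V. x \<in> h}"
        then obtain w where "w \<in> {p, q, a, b, c, d, e, f}" and h: "h = {x, w}"
          using at_x[of h "{p, q, a, b, c, d, e, f}"] unfolding V by blast
        then show "h \<in> {{x, p}, {x, q}, {x, a}, {x, b}, {x, c}, {x, d}, {x, e}, {x, f}, {p, q}}"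
          unfolding h by (elim insertE emptyE) simp_all
      qed
      have dec: "p5_decomp (pairs V) {{x, p}, {x, q}, {x, a}, {x, b}, {x, c}, {x, d}, {x, e}, {x, f}, {p, q}} {p, q, a, b, c, d, e, f}"
        using p5_decomp_K9_rooted[OF d] unfolding V .
      show ?thesis
        by (rule exI, rule exI, rule conjI[OF dec root])
    qed
  qed
qed

text \<open>The attached K_9 makes all eight new vertices internal. Its root is an old vertex and is
  internal by induction.\<close>

lemma p5_decomp_all_internal:
  assumes "finite V" "8 \<le> card V" "card V mod 8 = 0 \<or> card V mod 8 = 1"
  shows "\<exists>R I. p5_decomp (pairs V) R I \<and> V \<subseteq> I"
  using assms
proof (induction "card V" arbitrary: V rule: less_induct)
  case less
  show ?case
  proof (cases "16 \<le> card V")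
    case True
    obtain x where x: "x \<in> V" using True by fastforce
    obtain U p q a b c d e f where V: "V = U \<union> {p, q, a, b, c, d, e, f}" "x \<in> U" "finite U" "card V = card U + 8"
      and A: "distinct [p, q, a, b, c, d, e, f]" "{p, q, a, b, c, d, e, f} \<inter> U = {}"
      by (rule split_off_eight[OF less.prems(1) True x])
    have d: "distinct [x, p, q, a, b, c, d, e, f]" using A V(2) by auto
    obtain R I where R: "p5_decomp (pairs U) R I" "U \<subseteq> I"
      using less.hyps[of U] V True less.prems(3) by auto
    show ?thesis
      using p5_decomp_extend_by_eight[OF V(3,2) _ R(1) A p5_decomp_K9_rooted[OF d]] V(1,4) True R(2) by fastforce
  next
    case False
    then have "card V = 8 \<or> card V = 9" using less.prems by presburger
    then show ?thesis
      using p5_decomp_K8_internal p5_decomp_K9_internal by blast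
  qed
qed

section \<open>The spectra\<close>

lemma three_dvd_card_complement:
  assumes "finite V'" "card V' mod 3 = 0 \<or> card V' mod 3 = 1" "F \<subseteq> pairs V'" "3 dvd card F"
  shows "3 dvd card (pairs V' - F)"
proof -
  have "card (pairs V' - F) = card (pairs V') - card F"
    using assms finite_subset[OF assms(3)] by (intro card_Diff_subset) auto
  moreover have "card (pairs V') = card V' choose 2"
    using assms(1) by (simp add: n_subsets)
  ultimately show ?thesis
    using assms(2,4) three_dvd_choose_two dvd_diff_nat by metis
qed

lemma three_dvd_card_kept:
  assumes "p5_decomp E R I"
  shows "3 dvd card (E - R)"
proof -
  have "finite E" "R \<subseteq> E" "card E = 4 * card R"
    using p5_decomp_card[OF assms] by auto
  then have "card (E - R) = 3 * card R"
    by (simp add: card_Diff_subset finite_subset)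
  then show ?thesis by simp
qed

section \<open>Targets of order v + 1, v - 1 and v\<close>

lemma mem_L1_succ:
  fixes V :: "'a::infinite set"
  assumes V: "finite V" "8 \<le> card V" "card V mod 8 = 0 \<or> card V mod 8 = 1"
    and n: "Suc (card V) mod 3 = 0 \<or> Suc (card V) mod 3 = 1"
  shows "Suc (card V) \<in> L1 TYPE('a) (path_graph 5) (card V)"
proof -
  obtain x where x: "x \<in> V" using V(2) by fastforce
  obtain y where y: "y \<notin> V" using ex_new_if_finite[OF infinite_UNIV V(1)] by blast
  obtain R I where R: "p5_decomp (pairs V) R I" "{h \<in> pairs V. x \<in> h} \<subseteq> R"
    using p5_decomp_rooted[OF V(1) x V(2,3)] by blast
  let ?V = "insert y V"
  let ?E = "pairs ?V - (pairs V - R)"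
  have c: "card ?V = Suc (card V)" using V y by simp
  have sub: "pairs V - R \<subseteq> pairs ?V" by blast
  have "p4_decomp ?E"
  proof (rule p4_decomp_two_dominating[of ?V _ x y])
    show "finite ?V" "4 \<le> card ?V" "x \<in> ?V" "y \<in> ?V" "x \<noteq> y" "?E \<subseteq> pairs ?V"
      using V c x y by auto
    show "{x, y} \<in> ?E" using x y by auto
    show "{x, u} \<in> ?E \<and> {y, u} \<in> ?E" if "u \<in> ?V - {x, y}" for u
    proof (cases "u \<in> V")
      case True
      then have "{x, u} \<in> {h \<in> pairs V. x \<in> h}" using that x by auto
      then have "{x, u} \<in> R" using R(2) by blast
      then show ?thesis using True that x y by auto
    qed (use that in simp)
    show "3 dvd card ?E"
      using three_dvd_card_complement[OF _ _ sub three_dvd_card_kept[OF R(1)]] V(1) c n by simp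
  qed
  then show ?thesis
    using L1_memI[OF R(1) V(1) _ _ _ sub] V c by simp
qed

text \<open>All edges at \<open>x\<close> are removed, so the target can do without
  \<open>x\<close>. What remains to decompose are the removed edges not containing
  \<open>x\<close>.\<close>

lemma mem_L1_pred:
  fixes V :: "'a set"
  assumes V: "finite V" "8 \<le> card V" "card V mod 8 = 0 \<or> card V mod 8 = 1"
    and n: "(card V - 1) mod 3 = 0 \<or> (card V - 1) mod 3 = 1"
  shows "card V - 1 \<in> L1 TYPE('a) (path_graph 5) (card V)"
proof -
  obtain x where x: "x \<in> V" using V(2) by fastforce
  let ?V = "V - {x}"
  have c: "card ?V = card V - 1" using V x by simp
  have "\<exists>R I. p5_decomp (pairs V) R I \<and> {h \<in> pairs V. x \<in> h} \<subseteq> R \<and> p4_decomp (pairs ?V - (pairs V - R))"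
  proof (cases "16 \<le> card V")
    case True
    obtain U p q a b c d e f where U: "V = U \<union> {p, q, a, b, c, d, e, f}" "x \<in> U" "finite U" "card V = card U + 8"
      and A: "distinct [p, q, a, b, c, d, e, f]" "{p, q, a, b, c, d, e, f} \<inter> U = {}"
      by (rule split_off_eight[OF V(1) True x])
    have d: "distinct [x, p, q, a, b, c, d, e, f]" using A U(2) by auto
    obtain R0 I0 where R0: "p5_decomp (pairs U) R0 I0" "{h \<in> pairs U. x \<in> h} \<subseteq> R0"
      using p5_decomp_rooted[OF U(3,2)] U(4) True V(3) by auto
    define S where "S = {{x, p}, {x, q}, {x, a}, {x, b}, {x, c}, {x, d}, {x, e}, {x, f}, {p, q}}"
    define R where "R = R0 \<union> S \<union> spokes p q (U - {x})"
    obtain I where R: "p5_decomp (pairs V) R I"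
      using p5_decomp_extend_by_eight[OF U(3,2) _ R0(1) A p5_decomp_K9_rooted[OF d]] U(1,4) True
      unfolding R_def S_def by auto
    have R0U: "R0 \<subseteq> pairs U" using p5_decomp_card[OF R0(1)] by blast
    have RV: "R \<subseteq> pairs V" using p5_decomp_card[OF R] by blast
    have root: "{h \<in> pairs V. x \<in> h} \<subseteq> R"
      unfolding R_def S_def U(1) by (rule rooted_extend[OF U(2) R0(2)])
    have kept: "pairs V - R \<subseteq> pairs ?V" using root by blast
    define E where "E = pairs ?V - (pairs V - R)"
    have E: "E = {h \<in> R. x \<notin> h}" using RV unfolding E_def by blast
    have "p4_decomp E"
    proof (rule p4_decomp_two_dominating[of "U - {x} \<union> {p, q}" _ p q])
      have "card (U - {x} \<union> {p, q}) = card (U - {x}) + card {p, q}"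
        using U(3) A by (intro card_Un_disjoint) auto
      then show "4 \<le> card (U - {x} \<union> {p, q})"
        using U A True by simp
      \<comment> \<open>The removed edges at \<open>a\<close>, ..., \<open>f\<close> all contain
        \<open>x\<close>, so they are absent from \<open>E\<close>.\<close>
      show "E \<subseteq> pairs (U - {x} \<union> {p, q})"
        using R0U A unfolding E R_def S_def by (auto simp: spokes_def)
      show "3 dvd card E"
        unfolding E_def
        using three_dvd_card_complement[OF _ _ kept three_dvd_card_kept[OF R]] V(1) c n x by simp
      show "{p, q} \<in> E"
        using d by (simp add: E R_def S_def)
      show "{p, u} \<in> E \<and> {q, u} \<in> E" if "u \<in> U - {x} \<union> {p, q} - {p, q}" for u
        using that d unfolding E R_def by (auto simp: spokes_def)
    qed (use U A in auto)
    then show ?thesis using R root unfolding E_def by blast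
  next
    case False
    then have "card V = 8 \<or> card V = 9" using V(2,3) by presburger
    \<comment> \<open>Order 9 would have a target of order 8, which is 2 modulo 3.\<close>
    then have 8: "card V = 8" using n by auto
    obtain xs where xs: "distinct (x # xs)" "set (x # xs) = V" "length (x # xs) = card V"
      by (rule enumerate_with_head[OF V(1) x])
    then have "length xs = 7" using 8 by simp
    then obtain a b c d e f g where l: "xs = [a, b, c, d, e, f, g]"
      by (auto simp: numeral_eq_Suc length_Suc_conv)
    have d: "distinct [x, a, b, c, d, e, f, g]" using xs l by auto
    have V': "V = {x, a, b, c, d, e, f, g}" using xs(2) by (simp add: l)
    define R where "R = {{x, a}, {x, b}, {x, c}, {x, d}, {x, e}, {x, f}, {x, g}}"
    have R: "p5_decomp (pairs V) R {a, b, c, d, e, f, g}"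
      using p5_decomp_K8_rooted[OF d] unfolding V' R_def .
    have root: "{h \<in> pairs V. x \<in> h} \<subseteq> R"
    proof
      fix h assume h: "h \<in> {h \<in> pairs V. x \<in> h}"
      then obtain w where w: "h = {x, w}" "w \<noteq> x" "w \<in> V" using edge_at_vertex[of h V x] by blast
      then have "w \<in> {a, b, c, d, e, f, g}" unfolding V' by simp
      then show "h \<in> R" unfolding w(1) R_def by (elim insertE emptyE) simp_all
    qed
    \<comment> \<open>Exactly the star of \<open>x\<close> was removed, so the kept edges already
      fill the smaller complete graph.\<close>
    have "pairs ?V - (pairs V - R) = {}"
      by (auto simp: R_def)
    then have rest: "p4_decomp (pairs ?V - (pairs V - R))"
      by (simp only: p4_decomp.empty)
    show ?thesis
      by (rule exI, rule exI, rule conjI[OF R conjI[OF root rest]])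
  qed
  then obtain R I where R: "p5_decomp (pairs V) R I" "{h \<in> pairs V. x \<in> h} \<subseteq> R" "p4_decomp (pairs ?V - (pairs V - R))"
    by blast
  have "pairs V - R \<subseteq> pairs ?V" using R(2) by blast
  then show ?thesis
    using L1_memI[OF R(1) V(1) _ _ _ _ R(3)] V c by simp
qed

text \<open>On the same vertex set the removed edges themselves must be decomposed. They split into
  \<open>E\<close> on \<open>U\<close> with \<open>p\<close> and \<open>q\<close>, where these two
  dominate, and six stray edges \<open>T\<close>, which the flipped K_9 makes decomposable.\<close>

lemma mem_L1_same:
  fixes V :: "'a set"
  assumes V: "finite V" "8 \<le> card V" "card V mod 8 = 0 \<or> card V mod 8 = 1"
    and n: "card V mod 3 = 0 \<or> card V mod 3 = 1"
  shows "card V \<in> L1 TYPE('a) (path_graph 5) (card V)"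
proof -
  obtain x where x: "x \<in> V" using V(2) by fastforce
  have "\<exists>R I. p5_decomp (pairs V) R I \<and> p4_decomp R"
  proof (cases "16 \<le> card V")
    case True
    obtain U p q a b c d e f where U: "V = U \<union> {p, q, a, b, c, d, e, f}" "x \<in> U" "finite U" "card V = card U + 8"
      and A: "distinct [p, q, a, b, c, d, e, f]" "{p, q, a, b, c, d, e, f} \<inter> U = {}"
      by (rule split_off_eight[OF V(1) True x])
    have d: "distinct [x, p, q, a, b, c, d, e, f]" using A U(2) by auto
    obtain R0 I0 where R0: "p5_decomp (pairs U) R0 I0"
      using p5_decomp_rooted[OF U(3,2)] U(4) True V(3) by auto
    define S T where "S = {{x, p}, {x, q}, {p, q}}" and "T = {{x, a}, {x, b}, {x, c}, {x, d}, {p, c}, {a, b}}"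
    define E where "E = R0 \<union> S \<union> spokes p q (U - {x})"
    obtain J where J: "p5_decomp (pairs {x, p, q, a, b, c, d, e, f}) (S \<union> T) J"
      using p5_decomp_K9_flipped[OF d] unfolding S_def T_def by blast
    obtain I where "p5_decomp (pairs V) (R0 \<union> (S \<union> T) \<union> spokes p q (U - {x})) I"
      using p5_decomp_extend_by_eight[OF U(3,2) _ R0 A J] U(1,4) True by auto
    then have R: "p5_decomp (pairs V) (E \<union> T) I"
      by (simp add: E_def Un_ac)
    have R0U: "R0 \<subseteq> pairs U" using p5_decomp_card[OF R0] by blast
    have ET: "E \<inter> T = {}"
      using R0U d A(2) unfolding E_def S_def T_def by (auto simp: spokes_def doubleton_eq_iff)
    have T: "p4_decomp T" "card T = 6"
    proof -
      show "p4_decomp T"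
        by (rule p4_decompI[of "[[p, c, x, a], [a, b, x, d]]"])
          (use d distinct_rev[THEN iffD2, OF d] in \<open>simp_all add: T_def doubleton_eq_iff insert_commute\<close>)
      show "card T = 6"
        using d distinct_rev[THEN iffD2, OF d] by (simp add: T_def doubleton_eq_iff)
    qed
    have "p4_decomp E"
    proof (rule p4_decomp_two_dominating[of "U \<union> {p, q}" _ p q])
      have "card (U \<union> {p, q}) = card U + card {p, q}"
        using U(3) A by (intro card_Un_disjoint) auto
      then show "4 \<le> card (U \<union> {p, q})"
        using U A True by simp
      show "E \<subseteq> pairs (U \<union> {p, q})"
        using R0U A U(2) d unfolding E_def S_def by (auto simp: spokes_def)
      \<comment> \<open>3 divides the number of all edges, four times the number of removed ones,
        hence the latter too; \<open>T\<close> contributes 6.\<close>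
      have "finite (E \<union> T)" "card (pairs V) = 4 * card (E \<union> T)"
        using p5_decomp_card[OF R] finite_subset by blast+
      moreover have "3 dvd card (pairs V)"
        using V(1) n three_dvd_choose_two by (simp add: n_subsets)
      ultimately have "3 dvd card E + card T"
        using card_Un_disjoint[OF _ _ ET] by (simp; presburger)
      then show "3 dvd card E" using T(2) by presburger
      show "{p, q} \<in> E"
        by (simp add: E_def S_def)
      show "{p, u} \<in> E \<and> {q, u} \<in> E" if "u \<in> U \<union> {p, q} - {p, q}" for u
      proof (cases "u = x")
        case True
        then show ?thesis by (simp add: E_def S_def insert_commute)
      next
        case False
        then have "{p, u} \<in> spokes p q (U - {x})" "{q, u} \<in> spokes p q (U - {x})"
          using that by (auto simp: spokes_def)
        then show ?thesis by (simp add: E_def)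
      qed
    qed (use U A in auto)
    then show ?thesis using R p4_decomp_Un[OF _ T(1) ET] by blast
  next
    case False
    then have "card V = 8 \<or> card V = 9" using V(2,3) by presburger
    then have 9: "card V = 9" using n by auto
    obtain xs where xs: "set xs = V" "distinct xs"
      using finite_distinct_list V(1) by blast
    then have "length xs = 9" using 9 distinct_card by fastforce
    then obtain x p q a b c d e f where l: "xs = [x, p, q, a, b, c, d, e, f]"
      by (auto simp: numeral_eq_Suc length_Suc_conv)
    have d: "distinct [x, p, q, a, b, c, d, e, f]" using xs l by auto
    have V': "V = {x, p, q, a, b, c, d, e, f}" using xs(1) by (simp add: l)
    have "p4_decomp ({{x, p}, {x, q}, {p, q}} \<union> {{x, a}, {x, b}, {x, c}, {x, d}, {p, c}, {a, b}})"
      by (rule p4_decompI[of "[[a, x, p, c], [p, q, x, c], [a, b, x, d]]"])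
        (use d distinct_rev[THEN iffD2, OF d] in \<open>simp_all add: doubleton_eq_iff insert_commute\<close>)
    then show ?thesis
      using p5_decomp_K9_flipped[OF d] unfolding V' by blast
  qed
  then obtain R I where R: "p5_decomp (pairs V) R I" "p4_decomp R" by blast
  have "pairs V - (pairs V - R) = R"
    using p5_decomp_card[OF R(1)] by blast
  then show ?thesis
    using L1_memI[OF R(1) V(1) _ V(1)] V R(2) by simp
qed

text \<open>Blocks of an arbitrary design are not given as vertex lists, so the first four vertices
  of the standard path are pulled back along the isomorphism.\<close>

lemma isomorphic_path5_subgraph:
  assumes "isomorphic B (path_graph 5)"
  shows "\<exists>H. subgraph H B \<and> isomorphic H (path_graph 4)"
proof -
  obtain \<phi> where \<phi>: "bij_betw \<phi> (verts B) {..<5::nat}" "edges (path_graph 5) = (\<lambda>e. \<phi> ` e) ` edges B"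
    and B: "simple_graph B"
    using assms by (auto simp: isomorphic_def path_graph_def)
  define H where "H = ({v \<in> verts B. \<phi> v < 4}, {e \<in> edges B. \<phi> ` e \<subseteq> {..<4}})"
  have H: "simple_graph H" "subgraph H B"
    using B by (auto simp: H_def simple_graph_def subgraph_def)
  have "bij_betw \<phi> (verts H) {..<4}"
    using \<phi>(1) unfolding bij_betw_def H_def
  proof safe
    fix i :: nat assume "i < 4" "\<phi> ` verts B = {..<5}"
    then have "i \<in> \<phi> ` verts B" by simp
    then show "i \<in> \<phi> ` verts ({v \<in> verts B. \<phi> v < 4}, {e \<in> edges B. \<phi> ` e \<subseteq> {..<4}})"
      using \<open>i < 4\<close> by auto
  qed (auto intro: inj_on_subset)
  moreover have "edges (path_graph 4) = {h \<in> edges (path_graph 5). h \<subseteq> {..<4}}"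
    by (auto simp: path_graph_def)
  then have "edges (path_graph 4) = (\<lambda>e. \<phi> ` e) ` edges H"
    unfolding \<phi>(2) H_def by auto
  moreover have "verts (path_graph 4) = {..<4}" by (simp add: path_graph_def)
  ultimately have "isomorphic H (path_graph 4)"
    using H(1) simple_graph_path_graph[of 4] unfolding isomorphic_def by metis
  then show ?thesis using H(2) by blast
qed

lemma down_linked_two_new_vertices:
  fixes \<B> :: "'a::infinite graph set"
  assumes \<B>: "design_of_order (path_graph 5) v \<B>" and n: "v + 2 \<le> n" "n mod 3 = 0 \<or> n mod 3 = 1"
  shows "\<exists>\<B>'. design_of_order (path_graph 4) n \<B>' \<and> down_linked (path_graph 5) (path_graph 4) \<B> \<B>'"
proof -
  obtain V where V: "finite V" "card V = v" "design (complete_graph V) (path_graph 5) \<B>"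
    using \<B> by (auto simp: design_of_order_def)
  obtain N where N: "finite N" "card N = n - v" "N \<inter> V = {}"
  proof -
    have "infinite (- V)" using V(1) infinite_UNIV finite_compl by blast
    then obtain N where "finite N" "card N = n - v" "N \<subseteq> - V"
      using infinite_arbitrarily_large by blast
    then show ?thesis using that by blast
  qed
  obtain x y where xy: "x \<in> N" "y \<in> N" "x \<noteq> y"
  proof -
    obtain xs where xs: "distinct xs" "set xs \<subseteq> N" "length xs = 2"
    proof (rule obtain_distinct_list[OF N(1)])
      show "2 \<le> card N" using N(2) n(1) by simp
    qed
    then obtain x y where "xs = [x, y]" by (auto simp: length2_conv)
    then show ?thesis using that[of x y] xs by simp
  qed
  let ?V = "V \<union> N"
  have c: "card ?V = n" "finite ?V"
    using card_Un_disjoint[of V N] V N n(1) by auto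
  have v5: "5 \<le> v" using design_card(3)[OF V(1,3)] V(2) by (simp add: card_path_graph)
  have iso: "isomorphic B (path_graph 5)" if "B \<in> \<B>" for B
    using V(3) that by (simp add: design_def)
  \<comment> \<open>Any choice will do: the domination comes from the two new vertices, whichever
    end edge a block loses.\<close>
  define f where "f B = (SOME H. subgraph H B \<and> isomorphic H (path_graph 4))" for B :: "'a graph"
  have f: "subgraph (f B) B \<and> isomorphic (f B) (path_graph 4)" if "B \<in> \<B>" for B
    unfolding f_def using isomorphic_path5_subgraph[OF iso[OF that]] by (rule someI_ex)
  have fV: "verts (f B) \<subseteq> V" "edges (f B) \<subseteq> pairs V" "edges (f B) \<subseteq> edges B" if "B \<in> \<B>" for B
  proof -
    have "verts B \<subseteq> V" "edges B \<subseteq> pairs V"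
      using V(3) that by (simp_all add: design_def subgraph_def complete_graph_def)
    then show "verts (f B) \<subseteq> V" "edges (f B) \<subseteq> pairs V" "edges (f B) \<subseteq> edges B"
      using f[OF that] by (auto simp: subgraph_def)
  qed
  define F where "F = (\<Union>B\<in>\<B>. edges (f B))"
  have F: "F \<subseteq> pairs V" using fV(2) unfolding F_def by blast
  have "card F = (\<Sum>B\<in>\<B>. card (edges (f B)))"
    unfolding F_def
  proof (rule card_UN_disjoint[OF design_card(2)[OF V(1,3)]])
    show "\<forall>B\<in>\<B>. finite (edges (f B))"
      using finite_subset[OF fV(2)] V(1) by simp
    show "\<forall>A\<in>\<B>. \<forall>B\<in>\<B>. A \<noteq> B \<longrightarrow> edges (f A) \<inter> edges (f B) = {}"
    proof (intro ballI impI)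
      fix A B assume AB: "A \<in> \<B>" "B \<in> \<B>" "A \<noteq> B"
      then have "edges A \<inter> edges B = {}"
        using V(3) by (simp add: design_def disjoint_family_on_def)
      then show "edges (f A) \<inter> edges (f B) = {}"
        using fV(3)[OF AB(1)] fV(3)[OF AB(2)] by blast
    qed
  qed
  also have "\<dots> = (\<Sum>B\<in>\<B>. 3)"
  proof (rule sum.cong[OF refl])
    fix B assume "B \<in> \<B>"
    then show "card (edges (f B)) = 3"
      using isomorphic_card(2)[of "f B" "path_graph 4"] f by (simp add: card_path_graph)
  qed
  finally have cF: "3 dvd card F" by simp
  let ?E = "pairs ?V - F"
  have new: "{x, u} \<notin> F" "{y, u} \<notin> F" for u
    using F xy N(3) by blast+
  have "p4_decomp ?E"
  proof (rule p4_decomp_two_dominating[of ?V _ x y])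
    show "{x, y} \<in> ?E" using xy new by auto
    show "{x, u} \<in> ?E \<and> {y, u} \<in> ?E" if "u \<in> ?V - {x, y}" for u
      using that xy new by auto
    show "3 dvd card ?E"
      using three_dvd_card_complement[OF c(2) _ _ cF] c(1) n(2) F by blast
  qed (use c xy v5 n in auto)
  moreover have "verts (f B) \<subseteq> ?V" if "B \<in> \<B>" for B
    using fV(1)[OF that] by blast
  ultimately show ?thesis
    using exists_down_link[OF V(3) f c(2), folded F_def] c(1) v5 n(1) by simp
qed

theorem theorem4p5:
  fixes v :: nat
  assumes "v > 1"
    and "\<exists>\<B> :: 'a::infinite graph set. design_of_order (path_graph 5) v \<B>"
  shows "L1 TYPE('a) (path_graph 5) v = {n. n \<ge> v - 1 \<and> (n mod 3 = 0 \<or> n mod 3 = 1)}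
    \<and> {n. n \<ge> v + 2 \<and> (n mod 3 = 0 \<or> n mod 3 = 1)} \<subseteq> L2 TYPE('a) (path_graph 5) v
    \<and> L2 TYPE('a) (path_graph 5) v \<subseteq> {n. n \<ge> v \<and> (n mod 3 = 0 \<or> n mod 3 = 1)}"
proof -
  obtain \<B>0 :: "'a graph set" and V where \<B>0: "design_of_order (path_graph 5) v \<B>0"
    and V: "finite V" "card V = v" "design (complete_graph V) (path_graph 5) \<B>0"
    using assms(2) by (auto simp: design_of_order_def)
  have "5 \<le> v" "4 dvd v choose 2"
    using design_card(1,3)[OF V(1,3)] V(2) by (simp_all add: card_path_graph)
  then have v8: "5 \<le> v" "v mod 8 = 0 \<or> v mod 8 = 1"
    using four_dvd_choose_two by blast+
  then have v: "8 \<le> v" "v mod 8 = 0 \<or> v mod 8 = 1"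
    by presburger+
  have mod3: "n mod 3 = 0 \<or> n mod 3 = 1" if D: "design_of_order (path_graph 4) n \<B>'" for n and \<B>' :: "'a graph set"
  proof -
    obtain V' where "finite V'" "card V' = n" "design (complete_graph V') (path_graph 4) \<B>'"
      using D by (auto simp: design_of_order_def)
    then have "n choose 2 = card \<B>' * 3"
      using design_card(1)[of V' "path_graph 4" \<B>'] by (simp add: card_path_graph)
    then have "3 dvd n choose 2" by simp
    then show ?thesis by (simp only: three_dvd_choose_two)
  qed
  have L1_sub: "n \<ge> v - 1 \<and> (n mod 3 = 0 \<or> n mod 3 = 1)" if "n \<in> L1 TYPE('a) (path_graph 5) v" for n
  proof -
    obtain \<B> \<B>' :: "'a graph set" and f where L: "design_of_order (path_graph 5) v \<B>"
      "design_of_order (path_graph 4) n \<B>'" "down_link (path_graph 5) (path_graph 4) \<B> \<B>' f"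
      using \<open>n \<in> _\<close> unfolding L1_def down_linked_def by blast
    obtain W where W: "finite W" "card W = v" "design (complete_graph W) (path_graph 5) \<B>"
      using L(1) by (auto simp: design_of_order_def)
    obtain W' where W': "finite W'" "card W' = n" "design (complete_graph W') (path_graph 4) \<B>'"
      using L(2) by (auto simp: design_of_order_def)
    have "card (W - W') \<le> 1"
      using down_link_misses_at_most_one[OF W(3) W'(3) L(3)] W(1) by (simp add: card_le_Suc0_iff_eq)
    \<comment> \<open>Truncated subtraction is harmless: if \<open>W'\<close> is at least as large
      as \<open>W\<close>, the desired bound holds anyway.\<close>
    moreover have "card W - card W' \<le> card (W - W')"
      using diff_card_le_card_Diff[OF W'(1)] .
    ultimately show ?thesis
      using mod3[OF L(2)] W(2) W'(2) by linarith
  qed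
  have L2_sup: "n \<in> L2 TYPE('a) (path_graph 5) v" if "v + 2 \<le> n" "n mod 3 = 0 \<or> n mod 3 = 1" for n
    unfolding L2_def using down_linked_two_new_vertices[OF _ that] by blast
  have L1_sup: "n \<in> L1 TYPE('a) (path_graph 5) v" if n: "v - 1 \<le> n" "n mod 3 = 0 \<or> n mod 3 = 1" for n
  proof -
    consider "n = v - 1" | "n = v" | "n = Suc v" | "v + 2 \<le> n"
      using n(1) by linarith
    then show ?thesis
    proof cases
      case 1
      then show ?thesis using mem_L1_pred[OF V(1)] v n(2) V(2) by simp
    next
      case 2
      then show ?thesis using mem_L1_same[OF V(1)] v n(2) V(2) by simp
    next
      case 3
      then show ?thesis using mem_L1_succ[OF V(1)] v n(2) V(2) by simp
    next
      case 4
      then show ?thesis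
        using down_linked_two_new_vertices[OF \<B>0 _ n(2)] \<B>0 unfolding L1_def by blast
    qed
  qed
  have L2_sub: "v \<le> n \<and> (n mod 3 = 0 \<or> n mod 3 = 1)" if "n \<in> L2 TYPE('a) (path_graph 5) v" for n
  proof -
    \<comment> \<open>Membership in \<open>L2\<close> concerns every design of order v, so it may be
      applied to one in which all vertices are internal; none of them can then be missing from the
      target.\<close>
    obtain R I where I: "p5_decomp (pairs V) R I" "V \<subseteq> I"
      using p5_decomp_all_internal[of V] V(1) v unfolding V(2)[symmetric] by blast
    obtain \<B> where B: "design (complete_graph V) (path_graph 5) \<B>"
      "\<forall>u\<in>I. \<exists>p. distinct p \<and> length p = 5 \<and> path_on p \<in> \<B> \<and> u \<in> set (butlast (tl p))"
      using design_of_p5_decomp[OF I(1) V(1)] V(2) \<open>5 \<le> v\<close> by blast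
    have "design_of_order (path_graph 5) v \<B>"
      using B(1) V(1,2) by (auto simp: design_of_order_def)
    then obtain \<B>' f where L: "design_of_order (path_graph 4) n \<B>'"
      "down_link (path_graph 5) (path_graph 4) \<B> \<B>' f"
      using \<open>n \<in> _\<close> unfolding L2_def down_linked_def by blast
    obtain V' where V': "finite V'" "card V' = n" "design (complete_graph V') (path_graph 4) \<B>'"
      using L(1) by (auto simp: design_of_order_def)
    have "V \<subseteq> V'"
    proof
      fix u assume "u \<in> V"
      then have "u \<in> I" using I(2) by blast
      then obtain p where "distinct p" "length p = 5" "path_on p \<in> \<B>" "u \<in> set (butlast (tl p))"
        using B(2) by blast
      then show "u \<in> V'" by (rule down_link_keeps_internal[OF V'(3) L(2)])
    qed
    then show ?thesis
      using card_mono[OF V'(1)] V(2) V'(2) mod3[OF L(1)] by auto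
  qed
  show ?thesis
  proof (intro conjI equalityI subsetI)
    fix n
    show "n \<in> {n. n \<ge> v - 1 \<and> (n mod 3 = 0 \<or> n mod 3 = 1)}" if "n \<in> L1 TYPE('a) (path_graph 5) v"
      using L1_sub[OF that] by simp
    show "n \<in> L1 TYPE('a) (path_graph 5) v" if "n \<in> {n. n \<ge> v - 1 \<and> (n mod 3 = 0 \<or> n mod 3 = 1)}"
      using L1_sup that by simp
    show "n \<in> L2 TYPE('a) (path_graph 5) v" if "n \<in> {n. n \<ge> v + 2 \<and> (n mod 3 = 0 \<or> n mod 3 = 1)}"
      using L2_sup that by simp
    show "n \<in> {n. n \<ge> v \<and> (n mod 3 = 0 \<or> n mod 3 = 1)}" if "n \<in> L2 TYPE('a) (path_graph 5) v"
      using L2_sub[OF that] by simp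
  qed
qed

end
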